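(* There exists a constant $K>0$ such that for all $0<\delta\ll1$, if $U$ denotes the solution of $$i\partial_tU+\nu^2\partial_x^2U=\Pi(|U|^2U),\qquad U(0,x)=e^{ix}+\delta,\qquad \nu=e^{-\frac{\pi K}{2\delta^2}},$$ then $\|U(t^\delta)\|_{H^1}\simeq\frac1\delta$, where $t^\delta:=\dfrac{\pi}{\delta\sqrt{4+\delta^2}}$.
   Context: $\mathbb S^1=\mathbb R/2\pi\mathbb Z$. $\Pi$ is the Szegő projector $\Pi(\sum_{k\in\mathbb Z}u_ke^{ikx})=\sum_{k\ge0}u_ke^{ikx}$ on $L^2(\mathbb S^1)$; $L^2_+=\Pi(L^2(\mathbb S^1))$, $H^s_+=H^s(\mathbb S^1)\cap L^2_+$, with $\|u\|_{H^s}^2=\sum_k(1+k^2)^s|u_k|^2$. For data in $H^s_+$, $s\ge\frac12$, the solution is the unique global solution in $C(\mathbb R,H^s_+)$. "$0<\delta\ll1$" means for all $\delta\in(0,\delta_0)$ for some $\delta_0>0$; $A\simeq B$ means $c^{-1}B\le A\le cB$ with a constant $c>0$ independent of $\delta$. *)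

theory Defs
  imports "HOL-Analysis.Analysis"
begin

text \<open>
  Functions on the circle are represented by \<open>2 * pi\<close>-periodic functions on the real line.
  Elements of \<open>L2\<close> are honest functions, not classes; the norms below, being computed from
  Fourier coefficients, do not see null sets.
\<close>

definition fourier_coeff :: "(real \<Rightarrow> complex) \<Rightarrow> int \<Rightarrow> complex" where
  "fourier_coeff u k =
     complex_of_real (1 / (2 * pi)) * (LINT x:{0..2 * pi}|lborel. u x * cis (- (of_int k * x)))"

definition L2_circle :: "(real \<Rightarrow> complex) set" where
  "L2_circle = {u. u \<in> borel_measurable borel \<and> (\<forall>x. u (x + 2 * pi) = u x) \<and>
                   set_integrable lborel {0..2 * pi} (\<lambda>x. (norm (u x))\<^sup>2)}"

text \<open>
  The operators \<open>\<Pi>\<close> and \<open>\<partial>\<^sub>x\<^sup>2\<close> act on formal Fourier series, that is, on the coefficient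
  sequences of distributions on the circle.
\<close>

definition szego_proj :: "(int \<Rightarrow> complex) \<Rightarrow> int \<Rightarrow> complex" where
  "szego_proj a k = (if k \<ge> 0 then a k else 0)"

definition dxx :: "(int \<Rightarrow> complex) \<Rightarrow> int \<Rightarrow> complex" where
  "dxx a k = (\<i> * of_int k)\<^sup>2 * a k"

definition L2_plus :: "(real \<Rightarrow> complex) set" where
  "L2_plus = {u \<in> L2_circle. \<exists>v\<in>L2_circle. fourier_coeff u = szego_proj (fourier_coeff v)}"

lemma L2_plus_iff:
  "u \<in> L2_plus \<longleftrightarrow> u \<in> L2_circle \<and> (\<forall>k<0. fourier_coeff u k = 0)"
  by (auto simp: L2_plus_def szego_proj_def fun_eq_iff not_le intro!: bexI[of _ u])

definition sobolev_norm :: "real \<Rightarrow> (real \<Rightarrow> complex) \<Rightarrow> real" where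
  "sobolev_norm s u =
     sqrt (\<Sum>\<^sub>\<infinity>k\<in>UNIV. (1 + (of_int k)\<^sup>2) powr s * (norm (fourier_coeff u k))\<^sup>2)"

definition Hs_circle :: "real \<Rightarrow> (real \<Rightarrow> complex) set" where
  "Hs_circle s = {u \<in> L2_circle.
     (\<lambda>k. (1 + (of_int k)\<^sup>2) powr s * (norm (fourier_coeff u k))\<^sup>2) summable_on UNIV}"

definition Hs_plus :: "real \<Rightarrow> (real \<Rightarrow> complex) set" where
  "Hs_plus s = Hs_circle s \<inter> L2_plus"

definition continuous_into_Hs_plus :: "real \<Rightarrow> (real \<Rightarrow> real \<Rightarrow> complex) \<Rightarrow> bool" where
  "continuous_into_Hs_plus s U \<longleftrightarrow>
     (\<forall>t. U t \<in> Hs_plus s) \<and>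
     (\<forall>t. ((\<lambda>r. sobolev_norm s (\<lambda>x. U r x - U t x)) \<longlongrightarrow> 0) (at t))"

text \<open>
  The equation \<open>\<i> \<partial>\<^sub>t U + \<nu>\<^sup>2 \<partial>\<^sub>x\<^sup>2 U = \<Pi>(|U|\<^sup>2 U)\<close> is understood in the sense of distributions on
  the circle, i.e. tested against every character: \<open>V\<close> is the sequence of Fourier coefficients
  of \<open>\<partial>\<^sub>t U\<close> at time \<open>t\<close>.
\<close>

definition satisfies_nls_szego :: "real \<Rightarrow> (real \<Rightarrow> real \<Rightarrow> complex) \<Rightarrow> bool" where
  "satisfies_nls_szego \<nu> U \<longleftrightarrow>
     (\<forall>t. \<exists>V. (\<forall>k. ((\<lambda>r. fourier_coeff (U r) k) has_vector_derivative V k) (at t)) \<and>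
       (\<forall>k. \<i> * V k + complex_of_real (\<nu>\<^sup>2) * dxx (fourier_coeff (U t)) k
            = szego_proj (fourier_coeff (\<lambda>x. complex_of_real ((norm (U t x))\<^sup>2) * U t x)) k))"

definition nls_szego_solution ::
    "real \<Rightarrow> real \<Rightarrow> (real \<Rightarrow> complex) \<Rightarrow> (real \<Rightarrow> real \<Rightarrow> complex) \<Rightarrow> bool" where
  "nls_szego_solution s \<nu> u0 U \<longleftrightarrow>
     continuous_into_Hs_plus s U \<and> satisfies_nls_szego \<nu> U \<and> (AE x in lborel. U 0 x = u0 x)"

end

theory Submission imports Defs begin

text \<open>
  Without dispersion the equation is the cubic Szego equation
  \<open>\<i> \<partial>\<^sub>t u = \<Pi>(|u|\<^sup>2 u)\<close>, and the solution \<open>u\<close> starting from \<open>e\<^sup>i\<^sup>x + \<delta>\<close> is explicit: it stays of the form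
  \<open>(a z + b) / (1 - p z)\<close> with \<open>z = e\<^sup>i\<^sup>x\<close>, and its pole approaches the circle. Its \<open>H\<^sup>1\<close> norm is
  governed by \<open>\<rho> = 1 - |p|\<^sup>2\<close>, the conserved momentum forcing \<open>|u\<^sub>k| = \<rho> |p|\<^sup>k\<^sup>-\<^sup>1\<close> for \<open>k \<ge> 1\<close>, so that
  \<open>\<parallel>u\<parallel>\<^sup>2\<close> is comparable to \<open>1 / \<rho>\<close>. At the time \<open>t\<^sup>\<delta>\<close> one has \<open>\<rho> = \<delta>\<^sup>2 / (4 + \<delta>\<^sup>2)\<close>, which is where the
  size \<open>1 / \<delta>\<close> comes from (lemma \<open>norm_u_T\<close>).

  It remains to see that a dispersion of size \<open>\<nu>\<^sup>2 = exp (- \<pi> K / \<delta>\<^sup>2)\<close> does not disturb this before the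
  time \<open>t\<^sup>\<delta>\<close>. The difference \<open>w = U - u\<close> solves the equation with source \<open>\<nu>\<^sup>2 \<partial>\<^sub>x\<^sup>2 u\<close>, of size \<open>\<nu>\<^sup>2\<close> times
  a power of \<open>1 / \<delta>\<close>, and with a nonlinear term bounded by a constant times \<open>\<parallel>u\<parallel>\<^sup>2 \<parallel>w\<parallel>\<close> as long as \<open>w\<close> is
  small, because \<open>H\<^sup>1\<close> is an algebra. Hence \<open>w\<close> grows at most like the exponential of a multiple of
  \<open>\<integral> \<parallel>u\<parallel>\<^sup>2 dt\<close>. The rate \<open>\<parallel>u\<parallel>\<^sup>2 \<simeq> 1 / \<rho>\<close> is as large as \<open>\<delta>\<^sup>-\<^sup>2\<close> on an interval of length \<open>O(1)\<close>
  only: it is at most a multiple of \<open>1 / (\<delta>\<^sup>2 + \<phi>\<^sup>2)\<close> with a phase \<open>\<phi>\<close> that runs from \<open>\<pi> / 2\<close> to \<open>0\<close>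
  with speed \<open>\<omega> \<simeq> \<delta>\<close>. Therefore the integral over the whole of \<open>[0, t\<^sup>\<delta>]\<close> is \<open>O(\<delta>\<^sup>-\<^sup>2)\<close>, and a large
  \<open>K\<close> beats the amplification (lemma \<open>perturbation_bound\<close>).

  All estimates take place on Fourier coefficients. The link with functions is that the coefficients
  of an \<open>H\<^sup>1\<close> function are absolutely summable and that the function is almost everywhere the sum of
  its series (lemma \<open>AE_eq_fourier_series\<close>), which turns \<open>|U|\<^sup>2 U\<close> into a triple convolution.
\<close>

section \<open>Fourier coefficients of functions on the circle\<close>

lemma borel_measurable_cis [measurable]: "cis \<in> borel_measurable borel"
  by (intro borel_measurable_continuous_onI continuous_intros)

lemma set_integrable_mult_bounded:
  fixes f g :: "real \<Rightarrow> complex"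
  assumes f: "set_integrable lborel A f" and [measurable]: "A \<in> sets borel"
    and [measurable]: "g \<in> borel_measurable borel" and B: "\<And>x. norm (g x) \<le> B"
  shows "set_integrable lborel A (\<lambda>x. f x * g x)"
proof -
  have int: "integrable lborel (\<lambda>x. indicator A x *\<^sub>R f x)"
    using f by (simp add: set_integrable_def)
  have "integrable lborel (\<lambda>x. B * norm (indicator A x *\<^sub>R f x))"
    using int by (intro integrable_mult_right integrable_norm)
  moreover have "(\<lambda>x. (indicator A x *\<^sub>R f x) * g x) \<in> borel_measurable lborel"
    using borel_measurable_integrable[OF int] by measurable
  ultimately have "integrable lborel (\<lambda>x. (indicator A x *\<^sub>R f x) * g x)"
  proof (rule Bochner_Integration.integrable_bound)
    have "norm (indicator A x *\<^sub>R f x * g x) \<le> B * norm (indicator A x *\<^sub>R f x)" for x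
      using mult_left_mono[OF B norm_ge_zero[of "indicator A x *\<^sub>R f x"], of x]
      by (simp add: norm_mult algebra_simps)
    also have "B * norm (indicator A x *\<^sub>R f x) \<le> norm (B * norm (indicator A x *\<^sub>R f x))" for x
      by simp
    finally show "AE x in lborel. norm (indicator A x *\<^sub>R f x * g x) \<le> norm (B * norm (indicator A x *\<^sub>R f x))"
      by simp
  qed
  then show ?thesis
    by (simp add: set_integrable_def)
qed

lemma L2_circle_set_integrable:
  assumes "u \<in> L2_circle"
  shows "set_integrable lborel {0..2 * pi} u"
proof -
  have [measurable]: "u \<in> borel_measurable borel"
    and int: "set_integrable lborel {0..2 * pi} (\<lambda>x. (norm (u x))\<^sup>2)"
    using assms by (auto simp: L2_circle_def)
  have "set_integrable lborel {0..2 * pi} (\<lambda>x. 1 + (norm (u x))\<^sup>2 :: real)"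
    using int by (intro set_integral_add) (auto simp: set_integrable_def)
  then show ?thesis
  proof (rule set_integrable_bound)
    show "set_borel_measurable lborel {0..2 * pi} u"
      by (simp add: set_borel_measurable_def)
    have "norm (u x) \<le> norm (1 + (norm (u x))\<^sup>2)" for x
    proof -
      have "norm (u x) \<le> 1 + (norm (u x))\<^sup>2"
        using sum_squares_bound[of 1 "norm (u x)"] norm_ge_zero[of "u x"] by (simp del: norm_ge_zero)
      then show ?thesis by simp
    qed
    then show "AE x in lborel. x \<in> {0..2 * pi} \<longrightarrow> norm (u x) \<le> norm (1 + (norm (u x))\<^sup>2)"
      by simp
  qed
qed

lemma fourier_coeff_diff:
  assumes "set_integrable lborel {0..2 * pi} u" "set_integrable lborel {0..2 * pi} v"
  shows "fourier_coeff (\<lambda>x. u x - v x) k = fourier_coeff u k - fourier_coeff v k"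
proof -
  have "set_integrable lborel {0..2 * pi} (\<lambda>x. u x * cis (- (of_int k * x)))"
    "set_integrable lborel {0..2 * pi} (\<lambda>x. v x * cis (- (of_int k * x)))"
    using assms by (auto intro!: set_integrable_mult_bounded[where B=1])
  then show ?thesis
    unfolding fourier_coeff_def by (simp add: set_integral_diff algebra_simps)
qed

lemma fourier_coeff_cong_AE:
  assumes [measurable]: "u \<in> borel_measurable borel" "v \<in> borel_measurable borel"
    and "AE x in lborel. x \<in> {0..2 * pi} \<longrightarrow> u x = v x"
  shows "fourier_coeff u k = fourier_coeff v k"
proof -
  have "(LINT x:{0..2 * pi}|lborel. u x * cis (- (of_int k * x)))
      = (LINT x:{0..2 * pi}|lborel. v x * cis (- (of_int k * x)))"
    using assms(3) by (intro set_lebesgue_integral_cong_AE) (auto elim!: AE_mp)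
  then show ?thesis by (simp add: fourier_coeff_def)
qed

lemma integral_cis:
  "(LINT x:{0..2 * pi}|lborel. cis (of_int k * x)) = (if k = 0 then of_real (2 * pi) else 0)"
proof (cases "k = 0")
  case True
  then show ?thesis by (simp add: set_integral_const scaleR_conv_of_real)
next
  case False
  have "(LINT x|lborel. indicator {0..2*pi} x *\<^sub>R cis (of_int k * x))
     = cis (of_int k * (2 * pi)) / (\<i> * of_int k) - cis (of_int k * 0) / (\<i> * of_int k)"
  proof (rule integral_FTC_atLeastAtMost)
    fix x :: real
    have "((\<lambda>x. cis (of_int k * x)) has_vector_derivative
        (of_int k * 1) *\<^sub>R (\<i> * cis (of_int k * x))) (at x within {0..2*pi})"
      unfolding has_vector_derivative_def
      by (auto intro!: derivative_eq_intros simp: algebra_simps)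
    then have "((\<lambda>x. cis (of_int k * x) / (\<i> * of_int k)) has_vector_derivative
        ((of_int k * 1) *\<^sub>R (\<i> * cis (of_int k * x))) / (\<i> * of_int k)) (at x within {0..2*pi})"
      by (rule has_vector_derivative_divide)
    then show "((\<lambda>x. cis (of_int k * x) / (\<i> * of_int k)) has_vector_derivative
        cis (of_int k * x)) (at x within {0..2*pi})"
      using False by (simp add: scaleR_conv_of_real)
  qed (auto intro!: continuous_intros)
  moreover have "cis (of_int k * (2 * pi)) = 1"
    by (metis cis_multiple_2pi Ints_of_int mult.assoc mult.commute)
  ultimately show ?thesis
    using False by (simp add: set_lebesgue_integral_def)
qed

text \<open>The next lemmas show that Fourier coefficients determine an integrable function almost
  everywhere. Multiplication by a real polynomial in \<open>(cos x, sin x)\<close> only shifts and combines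
  coefficients. A function without coefficients is therefore orthogonal to all such polynomials, by
  Stone-Weierstrass to all continuous functions of \<open>cis x\<close>, and by dominated convergence to
  indicators of open sets.\<close>

lemma vanishing_coeffs_mult_polynomial:
  assumes "real_polynomial_function p"
    and "set_integrable lborel {0..2 * pi} h" "\<And>k. fourier_coeff h k = 0"
  shows "set_integrable lborel {0..2 * pi} (\<lambda>x. h x * of_real (p (cis x))) \<and>
         (\<forall>k. fourier_coeff (\<lambda>x. h x * of_real (p (cis x))) k = 0)"
  using assms
proof (induction arbitrary: h rule: real_polynomial_function.induct)
  case (linear p)
  interpret p: bounded_linear p by fact
  note h [intro] = linear(2)
  \<comment> \<open>a real linear form on the circle is a combination of \<open>cis x\<close> and \<open>cis (- x)\<close>\<close>
  define \<gamma> where "\<gamma> = (of_real (p 1) - \<i> * of_real (p \<i>)) / 2"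
  define \<gamma>' where "\<gamma>' = (of_real (p 1) + \<i> * of_real (p \<i>)) / 2"
  have eq: "of_real (p (cis x)) = \<gamma> * cis x + \<gamma>' * cis (- x)" for x
  proof -
    have "p (cis x) = p (cos x *\<^sub>R 1 + sin x *\<^sub>R \<i>)"
      by (rule arg_cong[where f=p]) (simp add: complex_eq_iff)
    also have "\<dots> = cos x * p 1 + sin x * p \<i>"
      by (simp only: p.add p.scaleR real_scaleR_def)
    finally show ?thesis
      by (simp add: \<gamma>_def \<gamma>'_def complex_eq_iff field_simps)
  qed
  have cis_int: "set_integrable lborel {0..2 * pi} (\<lambda>x. h x * cis (r * x))" for r
    by (rule set_integrable_mult_bounded[where B=1]) auto
  have z: "(LINT x:{0..2 * pi}|lborel. h x * cis (of_int k * x)) = 0" for k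
    using linear(3)[of "-k"] by (simp add: fourier_coeff_def)
  have "set_integrable lborel {0..2 * pi}
      (\<lambda>x. \<gamma> * (h x * cis (1 * x)) + \<gamma>' * (h x * cis ((-1) * x)))"
    by (intro set_integral_add set_integrable_mult_right cis_int)
  then have "set_integrable lborel {0..2 * pi} (\<lambda>x. h x * of_real (p (cis x)))"
    by (simp add: eq algebra_simps)
  moreover have "fourier_coeff (\<lambda>x. h x * of_real (p (cis x))) k = 0" for k
  proof -
    have "h x * of_real (p (cis x)) * cis (- (of_int k * x)) =
        \<gamma> * (h x * cis (of_int (1 - k) * x)) + \<gamma>' * (h x * cis (of_int (- 1 - k) * x))" for x
      unfolding eq by (simp add: algebra_simps cis_mult)
    then have "(LINT x:{0..2 * pi}|lborel. h x * of_real (p (cis x)) * cis (- (of_int k * x))) =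
      (LINT x:{0..2 * pi}|lborel. \<gamma> * (h x * cis (of_int (1 - k) * x)) + \<gamma>' * (h x * cis (of_int (- 1 - k) * x)))"
      by simp
    also have "\<dots> = 0"
      by (subst set_integral_add(2))
         (use z[of "1 - k"] z[of "- 1 - k"] cis_int in auto)
    finally show ?thesis by (simp add: fourier_coeff_def)
  qed
  ultimately show ?case by blast
next
  case (const c)
  have "fourier_coeff (\<lambda>x. h x * complex_of_real c) k = c * fourier_coeff h k" for k
  proof -
    have "(LINT x:{0..2 * pi}|lborel. h x * complex_of_real c * cis (- (of_int k * x)))
        = (LINT x:{0..2 * pi}|lborel. c * (h x * cis (- (of_int k * x))))"
      by (simp add: algebra_simps)
    then show ?thesis
      by (simp add: fourier_coeff_def)
  qed
  with const show ?case by auto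
next
  case (add p q)
  have *: "set_integrable lborel {0..2 * pi} (\<lambda>x. h x * of_real (p (cis x)))"
    "set_integrable lborel {0..2 * pi} (\<lambda>x. - (h x * of_real (q (cis x))))"
    using add.IH[OF add.prems] by (auto simp: set_integrable_def)
  have eq: "(\<lambda>x. h x * of_real (p (cis x) + q (cis x)))
      = (\<lambda>x. h x * of_real (p (cis x)) - (- (h x * of_real (q (cis x)))))"
    by (simp add: fun_eq_iff algebra_simps)
  have "fourier_coeff (\<lambda>x. - (h x * of_real (q (cis x)))) k = 0" for k
    using add.IH(2)[OF add.prems]
    by (auto simp: fourier_coeff_def set_lebesgue_integral_def)
  then have "fourier_coeff (\<lambda>x. h x * of_real (p (cis x) + q (cis x))) k = 0" for k
    unfolding eq using fourier_coeff_diff[OF *] add.IH(1)[OF add.prems] by simp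
  moreover have "set_integrable lborel {0..2 * pi} (\<lambda>x. h x * of_real (p (cis x) + q (cis x)))"
    unfolding eq using * by (rule set_integral_diff(1))
  ultimately show ?case by blast
next
  case (mult p q)
  from mult.IH(1)[OF mult.prems]
  have "set_integrable lborel {0..2 * pi} (\<lambda>x. h x * of_real (p (cis x)))"
    "\<And>k. fourier_coeff (\<lambda>x. h x * of_real (p (cis x))) k = 0"
    by auto
  from mult.IH(2)[OF this] show ?case
    by (simp add: mult.assoc)
qed

lemma vanishing_coeffs_orthogonal_continuous:
  fixes g :: "complex \<Rightarrow> real"
  assumes h: "set_integrable lborel {0..2 * pi} h" "\<And>k. fourier_coeff h k = 0"
    and g: "continuous_on UNIV g"
  shows "(LINT x:{0..2 * pi}|lborel. h x * of_real (g (cis x))) = 0"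
proof -
  let ?I = "{0..2 * pi}"
  define M where "M = (LINT x:?I|lborel. norm (h x))"
  have norm_int: "set_integrable lborel ?I (\<lambda>x. norm (h x))"
    using h(1) by (rule set_integrable_norm)
  have [measurable]: "g \<in> borel_measurable borel"
    using g by (rule borel_measurable_continuous_onI)
  have cis_circle: "cis x \<in> sphere 0 1" for x by simp
  have "compact (g ` sphere 0 1)"
    using g by (intro compact_continuous_image) (auto intro: continuous_on_subset)
  then have "bounded (g ` sphere 0 1)" by (rule compact_imp_bounded)
  then obtain B where "\<forall>y \<in> g ` sphere 0 1. norm y \<le> B"
    unfolding bounded_iff by blast
  then have B: "\<bar>g z\<bar> \<le> B" if "z \<in> sphere 0 1" for z
    using that by (metis imageI real_norm_def)
  have gint: "set_integrable lborel ?I (\<lambda>x. h x * of_real (g (cis x)))"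
    using h(1)
  proof (rule set_integrable_mult_bounded)
    show "norm (complex_of_real (g (cis x))) \<le> B" for x
      using B[OF cis_circle] by simp
  qed measurable
  have bound: "norm (LINT x:?I|lborel. h x * of_real (g (cis x))) \<le> e * M" if e: "e > 0" for e
  proof -
    have "continuous_on (sphere 0 1) g" using g by (rule continuous_on_subset) simp
    then obtain p where p: "real_polynomial_function p" "\<And>z. z \<in> sphere 0 1 \<Longrightarrow> \<bar>g z - p z\<bar> < e"
      using Stone_Weierstrass_real_polynomial_function[OF compact_sphere _ e] by blast
    note p_int = vanishing_coeffs_mult_polynomial[OF p(1) h]
    have p_zero: "(LINT x:?I|lborel. h x * of_real (p (cis x))) = 0"
      using p_int[THEN conjunct2, rule_format, of 0] by (simp add: fourier_coeff_def)
    have diff: "set_integrable lborel ?I (\<lambda>x. h x * of_real (g (cis x)) - h x * of_real (p (cis x)))"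
      using gint p_int by (intro set_integral_diff(1)) auto
    have "(LINT x:?I|lborel. h x * of_real (g (cis x))) =
        (LINT x:?I|lborel. h x * of_real (g (cis x)) - h x * of_real (p (cis x)))"
      using gint p_int p_zero by (simp add: set_integral_diff(2))
    also have "norm \<dots> \<le> (LINT x:?I|lborel. norm (h x * of_real (g (cis x)) - h x * of_real (p (cis x))))"
      using diff by (rule set_integral_norm_bound)
    also have "\<dots> \<le> (LINT x:?I|lborel. e * norm (h x))"
    proof (rule set_integral_mono)
      fix x
      have "norm (h x * of_real (g (cis x)) - h x * of_real (p (cis x)))
          = \<bar>g (cis x) - p (cis x)\<bar> * norm (h x)"
        by (simp add: right_diff_distrib[symmetric] norm_mult flip: of_real_diff)
      also have "\<dots> \<le> e * norm (h x)"
        using p(2)[OF cis_circle, of x] by (intro mult_right_mono) auto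
      finally show "norm (h x * of_real (g (cis x)) - h x * of_real (p (cis x))) \<le> e * norm (h x)" .
    qed (use diff norm_int in \<open>auto intro: set_integrable_norm\<close>)
    finally show ?thesis by (simp add: M_def)
  qed
  have "M \<ge> 0"
    unfolding M_def set_lebesgue_integral_def by (rule Bochner_Integration.integral_nonneg) auto
  have "norm (LINT x:?I|lborel. h x * of_real (g (cis x))) \<le> 0"
  proof (rule field_le_epsilon)
    fix e :: real assume "e > 0"
    with \<open>M \<ge> 0\<close> have "e / (M + 1) > 0" by simp
    then have "norm (LINT x:?I|lborel. h x * of_real (g (cis x))) \<le> e / (M + 1) * M"
      by (rule bound)
    also have "\<dots> \<le> 0 + e"
      using \<open>M \<ge> 0\<close> \<open>e > 0\<close> by (simp add: field_simps)
    finally show "norm (LINT x:?I|lborel. h x * of_real (g (cis x))) \<le> 0 + e" .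
  qed
  then show ?thesis by simp
qed


lemma two_pi_pos: "0 < 2 * pi"
  by simp

lemma cis_eq_imp_eq:
  assumes "cis x = cis y" "0 < x" "x < 2 * pi" "0 \<le> y" "y \<le> 2 * pi"
  shows "x = y"
proof -
  have "sin y = sin x \<and> cos y = cos x"
    using assms(1) by (metis cis.sel)
  then obtain n :: int where n: "y = x + 2 * pi * of_int n"
    unfolding sin_cos_eq_iff by blast
  then have "(2 * pi) * (-1) < (2 * pi) * of_int n" "(2 * pi) * of_int n < (2 * pi) * 1"
    using assms by linarith+
  then have "(-1::real) < of_int n" "of_int n < (1::real)"
    by (simp_all only: mult_less_cancel_left_pos[OF two_pi_pos])
  then have "n = 0" by linarith
  with n show ?thesis by simp
qed

lemma vanishing_coeffs_integral_open:
  assumes h: "set_integrable lborel {0..2 * pi} h" "\<And>k. fourier_coeff h k = 0"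
    and V: "open V"
  shows "(LINT x:{0<..<2 * pi} \<inter> V|lborel. h x) = 0"
proof -
  let ?I = "{0..2 * pi}"
  define W where "W = {0<..<2 * pi} \<inter> V"
  have "open W" using V by (simp add: W_def open_Int)
  then have [measurable]: "W \<in> sets borel" by simp
  define K where "K = cis ` (?I - W)"
  have "compact (?I - W)"
    using \<open>open W\<close> by (intro compact_diff) auto
  then have "compact K"
    unfolding K_def by (intro compact_continuous_image continuous_intros)
  have "0 \<in> ?I - W" by (simp add: W_def)
  then have K_ne: "K \<noteq> {}" unfolding K_def by blast
  have in_K: "cis x \<in> K \<longleftrightarrow> x \<notin> W" if "x \<in> ?I" for x
  proof
    assume "cis x \<in> K"
    then obtain y where "cis x = cis y" "y \<in> ?I - W" by (auto simp: K_def)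
    then show "x \<notin> W" using cis_eq_imp_eq[of x y] by (auto simp: W_def)
  qed (use that in \<open>auto simp: K_def\<close>)
  \<comment> \<open>continuous functions of \<open>cis x\<close> increasing to the indicator of \<open>W\<close>\<close>
  define g where "g n z = min 1 (real n * infdist z K)" for n z
  have g_cont: "continuous_on UNIV (g n)" for n
    unfolding g_def by (intro continuous_intros)
  then have [measurable]: "g n \<in> borel_measurable borel" for n
    by (rule borel_measurable_continuous_onI)
  have g_le: "\<bar>g n z\<bar> \<le> 1" for n z
    by (auto simp: g_def infdist_nonneg)
  have g_lim: "(\<lambda>n. g n (cis x)) \<longlonglongrightarrow> indicator W x" if "x \<in> ?I" for x
  proof (cases "x \<in> W")
    case False
    then have "infdist (cis x) K = 0" using in_K[OF that] by simp
    then show ?thesis using False by (simp add: g_def)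
  next
    case True
    then have "cis x \<notin> K" using in_K[OF that] by simp
    then have "infdist (cis x) K > 0"
      using \<open>compact K\<close> K_ne by (simp add: infdist_pos_not_in_closed compact_imp_closed)
    then obtain N where N: "1 < real N * infdist (cis x) K"
      using ex_less_of_nat_mult by blast
    have "g n (cis x) = 1" if "n \<ge> N" for n
    proof -
      have "real N * infdist (cis x) K \<le> real n * infdist (cis x) K"
        using that by (intro mult_right_mono) (auto simp: infdist_nonneg)
      with N show ?thesis by (simp add: g_def)
    qed
    then show ?thesis using True
      by (intro tendsto_eventually) (auto simp: eventually_sequentially)
  qed
  have int_h: "integrable lborel (\<lambda>x. indicator ?I x *\<^sub>R h x)"
    using h(1) by (simp add: set_integrable_def)
  have "(\<lambda>n. LINT x|lborel. indicator ?I x *\<^sub>R (h x * of_real (g n (cis x))))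
      \<longlonglongrightarrow> (LINT x|lborel. indicator W x *\<^sub>R h x)"
  proof (rule integral_dominated_convergence)
    show "integrable lborel (\<lambda>x. norm (indicator ?I x *\<^sub>R h x))"
      using int_h by (rule integrable_norm)
    have "set_integrable lborel W h"
      using h(1) by (rule set_integrable_subset) (use \<open>W \<in> sets borel\<close> in \<open>auto simp: W_def\<close>)
    then show "(\<lambda>x. indicator W x *\<^sub>R h x) \<in> borel_measurable lborel"
      by (auto simp: set_integrable_def)
    have "set_integrable lborel ?I (\<lambda>x. h x * of_real (g n (cis x)))" for n
      using g_le by (intro set_integrable_mult_bounded[where B=1] h(1)) auto
    then show "(\<lambda>x. indicator ?I x *\<^sub>R (h x * of_real (g n (cis x)))) \<in> borel_measurable lborel" for n
      by (auto simp: set_integrable_def)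
    have "norm (h x) * \<bar>g n (cis x)\<bar> \<le> norm (h x) * 1" for n x
      using g_le by (intro mult_left_mono) auto
    then show "AE x in lborel. norm (indicator ?I x *\<^sub>R (h x * of_real (g n (cis x))))
        \<le> norm (indicator ?I x *\<^sub>R h x)" for n
      by (intro AE_I2) (simp add: norm_mult indicator_def)
    show "AE x in lborel. (\<lambda>n. indicator ?I x *\<^sub>R (h x * of_real (g n (cis x))))
        \<longlonglongrightarrow> indicator W x *\<^sub>R h x"
    proof (rule AE_I2)
      fix x
      show "(\<lambda>n. indicator ?I x *\<^sub>R (h x * of_real (g n (cis x)))) \<longlonglongrightarrow> indicator W x *\<^sub>R h x"
      proof (cases "x \<in> ?I")
        case True
        have "(\<lambda>n. h x * of_real (g n (cis x))) \<longlonglongrightarrow> h x * of_real (indicator W x)"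
          by (intro tendsto_intros g_lim True)
        with True show ?thesis by (simp add: scaleR_conv_of_real mult.commute)
      next
        case False
        then have "x \<notin> W" by (auto simp: W_def)
        with False show ?thesis by simp
      qed
    qed
  qed
  moreover have "(LINT x|lborel. indicator ?I x *\<^sub>R (h x * of_real (g n (cis x)))) = 0" for n
    using vanishing_coeffs_orthogonal_continuous[OF h g_cont]
    by (simp add: set_lebesgue_integral_def)
  ultimately show ?thesis
    by (simp add: set_lebesgue_integral_def W_def LIMSEQ_const_iff)
qed

text \<open>The sets over which \<open>h\<close> integrates to zero form a Dynkin system. The restriction to the open
  interval avoids that \<open>0\<close> and \<open>2 * pi\<close> are the same point of the circle.\<close>
lemma vanishing_coeffs_AE_zero:
  assumes h: "set_integrable lborel {0..2 * pi} h" "\<And>k. fourier_coeff h k = 0"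
  shows "AE x in lborel. x \<in> {0..2 * pi} \<longrightarrow> h x = 0"
proof -
  define f where "f x = indicator {0<..<2 * pi} x *\<^sub>R h x" for x
  have "set_integrable lborel {0<..<2 * pi} h"
    using h(1) by (rule set_integrable_subset) auto
  then have f_int: "integrable lborel f"
    by (simp add: set_integrable_def f_def[abs_def])
  then have f_set_int: "set_integrable lborel A f" if "A \<in> sets borel" for A
    unfolding set_integrable_def using that by (intro integrable_mult_indicator) auto
  have f_open: "(LINT x:V|lborel. f x) = 0" if "open V" for V
    using vanishing_coeffs_integral_open[OF h that]
    by (simp add: set_lebesgue_integral_def f_def indicator_inter_arith mult.commute)
  have "(LINT x:A|lborel. f x) = 0" if "A \<in> sets borel" for A
  proof -
    have stable: "Int_stable {S :: real set. open S}" "{S :: real set. open S} \<subseteq> Pow UNIV"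
      by (auto simp: Int_stable_def)
    have gen: "A \<in> sigma_sets UNIV {S. open S}" using that by (simp add: sets_borel)
    show ?thesis
    proof (rule sigma_sets_induct_disjoint[OF stable gen, of "\<lambda>A. (LINT x:A|lborel. f x) = 0"])
      fix A assume A': "A \<in> sigma_sets UNIV {S. open S}" and zero: "(LINT x:A|lborel. f x) = 0"
      then have A: "A \<in> sets borel" by (simp add: sets_borel)
      have "(LINT x:UNIV|lborel. f x) = (LINT x:A \<union> (UNIV - A)|lborel. f x)"
        by simp
      also have "\<dots> = (LINT x:A|lborel. f x) + (LINT x:UNIV - A|lborel. f x)"
        by (rule set_integral_Un) (use A f_set_int in auto)
      finally show "(LINT x:UNIV - A|lborel. f x) = 0" using zero f_open[of UNIV] by simp
    next
      fix A :: "nat \<Rightarrow> real set"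
      assume A: "disjoint_family A" "range A \<subseteq> sigma_sets UNIV {S. open S}"
        and zero: "\<And>i. (LINT x:(A i)|lborel. f x) = 0"
      then have [measurable]: "A i \<in> sets borel" for i by (auto simp: sets_borel)
      have "(LINT x:(\<Union>i. A i)|lborel. f x) = (\<Sum>i. (LINT x:(A i)|lborel. f x))"
        using A(1) by (intro lebesgue_integral_countable_add f_set_int)
          (auto simp: disjoint_family_on_def)
      with zero show "(LINT x:(\<Union>i. A i)|lborel. f x) = 0" by simp
    qed (auto simp: f_open)
  qed
  then have "AE x in lborel. f x = 0"
    using f_int by (intro sigma_finite_measure.density_zero[OF sigma_finite_lborel]) auto
  moreover have "AE x in lborel. x \<noteq> 0" "AE x in lborel. x \<noteq> 2 * pi"
    by (rule AE_lborel_singleton)+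
  ultimately show ?thesis
    by eventually_elim (auto simp: f_def)
qed

\<comment> \<open>absolute summability is meant in the sense of \<open>has_sum\<close> throughout\<close>
no_notation Infinite_Set_Sum.abs_summable_on (infix \<open>abs'_summable'_on\<close> 50)

section \<open>Absolutely convergent Fourier series\<close>

definition fourier_series :: "(int \<Rightarrow> complex) \<Rightarrow> real \<Rightarrow> complex" where
  "fourier_series a x = (\<Sum>\<^sub>\<infinity>k. a k * cis (of_int k * x))"

definition conv :: "(int \<Rightarrow> complex) \<Rightarrow> (int \<Rightarrow> complex) \<Rightarrow> int \<Rightarrow> complex" where
  "conv a b k = (\<Sum>\<^sub>\<infinity>j. a j * b (k - j))"

definition conj_coeffs :: "(int \<Rightarrow> complex) \<Rightarrow> int \<Rightarrow> complex" where
  "conj_coeffs a k = cnj (a (- k))"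

lemma fourier_series_abs_summable:
  assumes "a abs_summable_on UNIV"
  shows "(\<lambda>k. a k * cis (of_int k * x)) abs_summable_on UNIV"
  using assms by (simp add: norm_mult)

lemma fourier_series_summable:
  assumes "a abs_summable_on UNIV"
  shows "(\<lambda>k. a k * cis (of_int k * x)) summable_on UNIV"
  using fourier_series_abs_summable[OF assms] by (rule Infinite_Sum.abs_summable_summable)

lemma fourier_series_uniform_limit:
  assumes "a abs_summable_on UNIV"
  shows "uniform_limit UNIV (\<lambda>F x. \<Sum>k\<in>F. a k * cis (of_int k * x)) (fourier_series a)
           (finite_subsets_at_top UNIV)"
  unfolding fourier_series_def
  using assms by (intro Weierstrass_m_test_general[where M = "\<lambda>k. norm (a k)"]) (auto simp: norm_mult)

lemma fourier_series_continuous: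
  assumes "a abs_summable_on UNIV"
  shows "continuous_on UNIV (fourier_series a)"
  by (rule uniform_limit_theorem[OF _ fourier_series_uniform_limit[OF assms]])
     (auto intro!: always_eventually continuous_intros)

lemma fourier_series_measurable:
  assumes "a abs_summable_on UNIV"
  shows "fourier_series a \<in> borel_measurable borel"
  using fourier_series_continuous[OF assms] by (rule borel_measurable_continuous_onI)

lemma fourier_series_set_integrable:
  assumes "a abs_summable_on UNIV"
  shows "set_integrable lborel {0..2 * pi} (fourier_series a)"
proof -
  have "continuous_on {0..2 * pi} (fourier_series a)"
    using fourier_series_continuous[OF assms] by (rule continuous_on_subset) simp
  then show ?thesis
    by (rule borel_integrable_atLeastAtMost')
qed

text \<open>The partial sums converge uniformly, and as soon as a partial sum contains the mode \<open>n\<close>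
  its \<open>n\<close>-th coefficient is exactly \<open>a n\<close>.\<close>
lemma fourier_coeff_fourier_series:
  assumes "a abs_summable_on UNIV"
  shows "fourier_coeff (fourier_series a) n = a n"
proof -
  let ?I = "{0..2 * pi}"
  define P where "P F x = (\<Sum>k\<in>F. a k * cis (of_int k * x))" for F x
  have P_cont: "continuous_on A (P F)" for A F
    unfolding P_def by (intro continuous_intros)
  have P_int: "set_integrable lborel ?I (P F)" for F
    using P_cont by (rule borel_integrable_atLeastAtMost')
  have P_coeff: "fourier_coeff (P F) n = a n" if "finite F" "n \<in> F" for F
  proof -
    have term_int: "set_integrable lborel ?I (\<lambda>x. a k * cis (of_int (k - n) * x))" for k
      by (intro borel_integrable_atLeastAtMost' continuous_intros)
    have "(LINT x:?I|lborel. P F x * cis (- (of_int n * x)))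
        = (LINT x:?I|lborel. (\<Sum>k\<in>F. a k * cis (of_int (k - n) * x)))"
      by (simp add: P_def sum_distrib_right mult.assoc cis_mult left_diff_distrib)
    also have "\<dots> = (\<Sum>k\<in>F. (LINT x:?I|lborel. a k * cis (of_int (k - n) * x)))"
      unfolding set_lebesgue_integral_def
      by (simp only: scaleR_sum_right)
         (rule Bochner_Integration.integral_sum, use term_int in \<open>simp add: set_integrable_def\<close>)
    also have "\<dots> = (\<Sum>k\<in>F. a k * (if k - n = 0 then of_real (2 * pi) else 0))"
      by (simp only: set_integral_mult_right integral_cis)
    also have "\<dots> = (\<Sum>k\<in>F. if k = n then a n * of_real (2 * pi) else 0)"
      by (intro sum.cong) auto
    also have "\<dots> = a n * of_real (2 * pi)"
      using that by simp
    finally show ?thesis by (simp add: fourier_coeff_def)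
  qed
  have "dist (fourier_coeff (fourier_series a) n) (a n) \<le> 0"
  proof (rule field_le_epsilon)
    fix e :: real assume e: "e > 0"
    have "\<forall>\<^sub>F F in finite_subsets_at_top UNIV. \<forall>x\<in>UNIV. dist (P F x) (fourier_series a x) < e"
      using uniform_limitD[OF fourier_series_uniform_limit[OF assms] e] by (simp add: P_def)
    moreover have "\<forall>\<^sub>F F in finite_subsets_at_top (UNIV::int set). finite F \<and> {n} \<subseteq> F"
      unfolding eventually_finite_subsets_at_top by (intro exI[of _ "{n}"]) auto
    ultimately have "\<forall>\<^sub>F F in finite_subsets_at_top (UNIV::int set).
        finite F \<and> n \<in> F \<and> (\<forall>x. dist (P F x) (fourier_series a x) < e)"
      by eventually_elim auto
    from eventually_happens'[OF finite_subsets_at_top_neq_bot this]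
    obtain F where F: "finite F" "n \<in> F" and close: "\<And>x. dist (P F x) (fourier_series a x) < e"
      by blast
    define d where "d x = fourier_series a x - P F x" for x
    have d_int: "set_integrable lborel ?I (\<lambda>x. d x * cis (- (of_int n * x)))"
    proof (rule borel_integrable_atLeastAtMost')
      have "continuous_on ?I (fourier_series a)"
        using fourier_series_continuous[OF assms] by (rule continuous_on_subset) simp
      then show "continuous_on ?I (\<lambda>x. d x * cis (- (of_int n * x)))"
        unfolding d_def by (intro continuous_intros P_cont)
    qed
    have "fourier_coeff (fourier_series a) n - a n = fourier_coeff d n"
      unfolding d_def
      by (simp add: fourier_coeff_diff fourier_series_set_integrable assms P_int P_coeff F)
    also have "norm \<dots> = 1 / (2 * pi) * norm (LINT x:?I|lborel. d x * cis (- (of_int n * x)))"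
      by (simp add: fourier_coeff_def norm_mult norm_divide)
    also have "\<dots> \<le> 1 / (2 * pi) * (2 * pi * e)"
    proof (rule mult_left_mono)
      have "norm (LINT x:?I|lborel. d x * cis (- (of_int n * x)))
          \<le> (LINT x:?I|lborel. norm (d x * cis (- (of_int n * x))))"
        using d_int by (rule set_integral_norm_bound)
      also have "\<dots> \<le> (LINT x:?I|lborel. e)"
      proof (rule set_integral_mono)
        show "norm (d x * cis (- (of_int n * x))) \<le> e" for x
          using close[of x] by (simp add: d_def norm_mult dist_norm norm_minus_commute[of "fourier_series a x"])
        show "set_integrable lborel ?I (\<lambda>x. norm (d x * cis (- (of_int n * x))))"
          using d_int by (rule set_integrable_norm)
        show "set_integrable lborel ?I (\<lambda>x. e)"
          by (rule borel_integrable_atLeastAtMost') (rule continuous_on_const)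
      qed
      also have "\<dots> = 2 * pi * e"
        by (simp add: set_integral_const)
      finally show "norm (LINT x:?I|lborel. d x * cis (- (of_int n * x))) \<le> 2 * pi * e" .
    qed simp
    also have "\<dots> = e" by simp
    finally show "dist (fourier_coeff (fourier_series a) n) (a n) \<le> 0 + e" by (simp add: dist_norm)
  qed
  then show ?thesis by simp
qed

lemma fourier_series_inject:
  assumes "a abs_summable_on UNIV" "b abs_summable_on UNIV" "fourier_series a = fourier_series b"
  shows "a = b"
  using fourier_coeff_fourier_series[OF assms(1)] fourier_coeff_fourier_series[OF assms(2)] assms(3)
  by auto

text \<open>The function and the sum of its series have the same coefficients, so their difference has none.\<close>
lemma AE_eq_fourier_series:
  assumes u: "u \<in> L2_circle" and sum: "fourier_coeff u abs_summable_on UNIV"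
  shows "AE x in lborel. x \<in> {0..2 * pi} \<longrightarrow> u x = fourier_series (fourier_coeff u) x"
proof -
  have "AE x in lborel. x \<in> {0..2 * pi} \<longrightarrow> u x - fourier_series (fourier_coeff u) x = 0"
  proof (rule vanishing_coeffs_AE_zero)
    show "set_integrable lborel {0..2 * pi} (\<lambda>x. u x - fourier_series (fourier_coeff u) x)"
      by (intro set_integral_diff L2_circle_set_integrable u fourier_series_set_integrable sum)
    show "fourier_coeff (\<lambda>x. u x - fourier_series (fourier_coeff u) x) k = 0" for k
      by (simp add: fourier_coeff_diff L2_circle_set_integrable u fourier_series_set_integrable sum
           fourier_coeff_fourier_series)
  qed
  then show ?thesis by simp
qed

lemma fourier_series_add:
  assumes "a abs_summable_on UNIV" "b abs_summable_on UNIV"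
  shows "fourier_series (\<lambda>k. a k + b k) x = fourier_series a x + fourier_series b x"
  unfolding fourier_series_def distrib_right
  by (intro infsum_add fourier_series_summable assms)

lemma fourier_series_cmult:
  "fourier_series (\<lambda>k. c * a k) x = c * fourier_series a x"
  unfolding fourier_series_def mult.assoc by (rule infsum_cmult_right')

lemma conj_coeffs_abs_summable:
  assumes "a abs_summable_on UNIV"
  shows "conj_coeffs a abs_summable_on UNIV"
proof -
  have "(\<lambda>k. norm (a (- k))) summable_on UNIV"
    using assms by (subst summable_on_reindex_bij_witness[of _ uminus uminus UNIV "\<lambda>k. norm (a k)"]) auto
  then show ?thesis by (simp add: conj_coeffs_def)
qed

lemma fourier_series_conj: "fourier_series (conj_coeffs a) x = cnj (fourier_series a x)"
proof -
  have "cnj (fourier_series a x) = (\<Sum>\<^sub>\<infinity>k. cnj (a k) * cis (- (of_int k * x)))"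
    unfolding fourier_series_def by (simp flip: infsum_cnj add: cis_cnj)
  also have "\<dots> = fourier_series (conj_coeffs a) x"
    unfolding fourier_series_def conj_coeffs_def
    by (rule infsum_reindex_bij_witness[of _ uminus uminus]) auto
  finally show ?thesis by simp
qed

lemma abs_summable_convolution_family:
  fixes a b :: "int \<Rightarrow> complex"
  assumes "a abs_summable_on UNIV" "b abs_summable_on UNIV"
  shows "(\<lambda>(k, j). a j * b (k - j)) abs_summable_on UNIV"
proof -
  have "(\<lambda>(j, l). a j * b l) abs_summable_on UNIV \<times> UNIV"
  proof (rule Infinite_Sum.abs_summable_on_Sigma_iff[THEN iffD2], intro conjI ballI)
    show "(\<lambda>l. norm (case (j, l) of (j, l) \<Rightarrow> a j * b l)) summable_on UNIV" for j
      using summable_on_cmult_right[OF assms(2), of "norm (a j)"] by (simp only: prod.case norm_mult)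
    have "(\<lambda>j. norm (a j) * (\<Sum>\<^sub>\<infinity>l. norm (b l))) summable_on UNIV"
      using assms(1) by (rule summable_on_cmult_left)
    moreover have "(\<Sum>\<^sub>\<infinity>l. norm (a j * b l)) = norm (a j) * (\<Sum>\<^sub>\<infinity>l. norm (b l))" for j
      unfolding norm_mult by (rule infsum_cmult_right')
    moreover have "0 \<le> (\<Sum>\<^sub>\<infinity>l. norm (b l))"
      by (intro infsum_nonneg) simp
    ultimately show "(\<lambda>j. norm (\<Sum>\<^sub>\<infinity>l. norm (case (j, l) of (j, l) \<Rightarrow> a j * b l))) summable_on UNIV"
      by (simp only: prod.case real_norm_def abs_mult abs_norm_cancel abs_of_nonneg)
  qed
  then have "(\<lambda>(j, l). norm (a j * b l)) summable_on UNIV"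
    by (simp add: case_prod_unfold)
  also have "?this \<longleftrightarrow> (\<lambda>(k, j). norm (a j * b (k - j))) summable_on UNIV"
    by (rule summable_on_reindex_bij_witness[of _ "\<lambda>(k, j). (j, k - j)" "\<lambda>(j, l). (j + l, j)"]) auto
  finally show ?thesis
    by (simp add: case_prod_unfold)
qed

lemma conv_abs_summable:
  assumes "a abs_summable_on UNIV" "b abs_summable_on UNIV"
  shows "conv a b abs_summable_on UNIV"
proof -
  have *: "(\<lambda>(k, j). a j * b (k - j)) abs_summable_on UNIV \<times> UNIV"
    using abs_summable_convolution_family[OF assms] by simp
  from Infinite_Sum.abs_summable_on_Sigma_iff[THEN iffD1, OF this]
  have row: "\<And>k. (\<lambda>j. a j * b (k - j)) abs_summable_on UNIV"
    and col: "(\<lambda>k. \<Sum>\<^sub>\<infinity>j. norm (a j * b (k - j))) abs_summable_on UNIV"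
    by simp_all
  have "(\<lambda>k. \<Sum>\<^sub>\<infinity>j. norm (a j * b (k - j))) summable_on UNIV"
    using col by (rule Infinite_Sum.abs_summable_summable)
  then show ?thesis
  proof (rule Infinite_Sum.abs_summable_on_comparison_test')
    show "norm (conv a b k) \<le> (\<Sum>\<^sub>\<infinity>j. norm (a j * b (k - j)))" for k
      unfolding conv_def using row by (rule norm_infsum_bound)
  qed
qed

text \<open>Absolute convergence of the double family allows summing first over one factor. Together
  with injectivity of \<^const>\<open>fourier_series\<close>, this reduces identities between convolutions to pointwise
  identities between complex numbers.\<close>
lemma fourier_series_conv:
  assumes "a abs_summable_on UNIV" "b abs_summable_on UNIV"
  shows "fourier_series (conv a b) x = fourier_series a x * fourier_series b x"
proof -
  define A where "A k = a k * cis (of_int k * x)" for k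
  define B where "B k = b k * cis (of_int k * x)" for k
  have A: "A abs_summable_on UNIV" and B: "B abs_summable_on UNIV"
    unfolding A_def B_def by (rule fourier_series_abs_summable, fact)+
  have sum: "(\<lambda>(k, j). A j * B (k - j)) summable_on UNIV \<times> UNIV"
    using Infinite_Sum.abs_summable_summable[OF abs_summable_convolution_family[OF A B]] by simp
  have "fourier_series (conv a b) x = (\<Sum>\<^sub>\<infinity>k. \<Sum>\<^sub>\<infinity>j. A j * B (k - j))"
    unfolding fourier_series_def conv_def A_def B_def
  proof (rule infsum_cong)
    fix k
    have "(\<Sum>\<^sub>\<infinity>j. a j * b (k - j)) * cis (of_int k * x) = (\<Sum>\<^sub>\<infinity>j. a j * b (k - j) * cis (of_int k * x))"
      by (rule infsum_cmult_left'[symmetric])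
    also have "\<dots> = (\<Sum>\<^sub>\<infinity>j. a j * cis (of_int j * x) * (b (k - j) * cis (of_int (k - j) * x)))"
    proof (rule infsum_cong)
      fix j
      have "cis (of_int k * x) = cis (of_int j * x) * cis (of_int (k - j) * x)"
        by (simp add: cis_mult algebra_simps)
      then show "a j * b (k - j) * cis (of_int k * x)
          = a j * cis (of_int j * x) * (b (k - j) * cis (of_int (k - j) * x))"
        by simp
    qed
    finally show "(\<Sum>\<^sub>\<infinity>j. a j * b (k - j)) * cis (of_int k * x)
        = (\<Sum>\<^sub>\<infinity>j. a j * cis (of_int j * x) * (b (k - j) * cis (of_int (k - j) * x)))" .
  qed
  also have "\<dots> = (\<Sum>\<^sub>\<infinity>j. \<Sum>\<^sub>\<infinity>k. A j * B (k - j))"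
    using sum by (rule infsum_swap_banach)
  also have "\<dots> = (\<Sum>\<^sub>\<infinity>j. A j * (\<Sum>\<^sub>\<infinity>k. B k))"
  proof (rule infsum_cong)
    fix j
    have "(\<Sum>\<^sub>\<infinity>k. B (k - j)) = (\<Sum>\<^sub>\<infinity>k. B k)"
      by (rule infsum_reindex_bij_witness[of _ "\<lambda>k. k + j" "\<lambda>k. k - j"]) auto
    then show "(\<Sum>\<^sub>\<infinity>k. A j * B (k - j)) = A j * (\<Sum>\<^sub>\<infinity>k. B k)"
      by (simp add: infsum_cmult_right')
  qed
  also have "\<dots> = (\<Sum>\<^sub>\<infinity>j. A j) * (\<Sum>\<^sub>\<infinity>k. B k)"
    by (rule infsum_cmult_left')
  finally show ?thesis by (simp add: fourier_series_def A_def B_def)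
qed

section \<open>Sequences with finite \<open>H\<^sup>1\<close> norm\<close>

text \<open>Bounds are stated on finite partial sums. This form contains the finiteness of the norm, is
  stable under limits of coefficients, and lets every estimate below be a finite computation.\<close>
definition H1_le :: "(int \<Rightarrow> complex) \<Rightarrow> real \<Rightarrow> bool" where
  "H1_le a M \<longleftrightarrow> 0 \<le> M \<and>
     (\<forall>F. finite F \<longrightarrow> (\<Sum>k\<in>F. (1 + (of_int k)\<^sup>2) * (norm (a k))\<^sup>2) \<le> M\<^sup>2)"

lemma H1_leD:
  "H1_le a M \<Longrightarrow> finite F \<Longrightarrow> (\<Sum>k\<in>F. (1 + (of_int k)\<^sup>2) * (norm (a k))\<^sup>2) \<le> M\<^sup>2"
  by (simp add: H1_le_def)

lemma H1_le_nonneg: "H1_le a M \<Longrightarrow> 0 \<le> M"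
  by (simp add: H1_le_def)

lemma H1_le_summable:
  assumes "H1_le a M"
  shows "(\<lambda>k. (1 + (of_int k)\<^sup>2) * (norm (a k))\<^sup>2) summable_on UNIV"
  using assms
  by (intro nonneg_bdd_above_summable_on bdd_aboveI[where M = "M\<^sup>2"]) (auto simp: H1_le_def)

lemma H1_le_dominated:
  assumes "H1_le a M" "\<And>k. norm (b k) \<le> norm (a k)"
  shows "H1_le b M"
  unfolding H1_le_def
proof (intro conjI allI impI)
  fix F :: "int set" assume "finite F"
  have "(\<Sum>k\<in>F. (1 + (of_int k)\<^sup>2) * (norm (b k))\<^sup>2) \<le> (\<Sum>k\<in>F. (1 + (of_int k)\<^sup>2) * (norm (a k))\<^sup>2 :: real)"
    using assms(2) by (intro sum_mono mult_left_mono power_mono) auto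
  also have "\<dots> \<le> M\<^sup>2" using assms(1) \<open>finite F\<close> by (rule H1_leD)
  finally show "(\<Sum>k\<in>F. (1 + (of_int k)\<^sup>2) * (norm (b k))\<^sup>2) \<le> M\<^sup>2" .
qed (use assms H1_le_nonneg in auto)

lemma H1_le_mono: "H1_le a M \<Longrightarrow> M \<le> N \<Longrightarrow> H1_le a N"
  unfolding H1_le_def by (auto intro: order_trans power_mono)

lemma H1_le_iff_L2_set:
  "H1_le a M \<longleftrightarrow> 0 \<le> M \<and>
     (\<forall>F. finite F \<longrightarrow> L2_set (\<lambda>k. sqrt (1 + (of_int k)\<^sup>2) * norm (a k)) F \<le> M)"
proof -
  have "L2_set (\<lambda>k. sqrt (1 + (of_int k)\<^sup>2) * norm (a k)) F \<le> M \<longleftrightarrow>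
      (\<Sum>k\<in>F. (1 + (of_int k)\<^sup>2) * (norm (a k))\<^sup>2) \<le> M\<^sup>2" if "M \<ge> 0" for F
    unfolding L2_set_def
    by (subst real_sqrt_le_iff[symmetric]) (use that in \<open>simp add: power_mult_distrib\<close>)
  then show ?thesis unfolding H1_le_def by blast
qed

lemma H1_le_add:
  assumes "H1_le a M" "H1_le b N"
  shows "H1_le (\<lambda>k. a k + b k) (M + N)"
  unfolding H1_le_iff_L2_set
proof (intro conjI allI impI)
  fix F :: "int set" assume F: "finite F"
  have "L2_set (\<lambda>k. sqrt (1 + (of_int k)\<^sup>2) * norm (a k + b k)) F
      \<le> L2_set (\<lambda>k. sqrt (1 + (of_int k)\<^sup>2) * norm (a k) + sqrt (1 + (of_int k)\<^sup>2) * norm (b k)) F"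
    by (intro L2_set_mono) (auto simp: norm_triangle_ineq simp flip: distrib_left intro!: mult_left_mono)
  also have "\<dots> \<le> L2_set (\<lambda>k. sqrt (1 + (of_int k)\<^sup>2) * norm (a k)) F
      + L2_set (\<lambda>k. sqrt (1 + (of_int k)\<^sup>2) * norm (b k)) F"
    by (rule L2_set_triangle_ineq)
  also have "\<dots> \<le> M + N"
    using assms F by (intro add_mono) (auto simp: H1_le_iff_L2_set)
  finally show "L2_set (\<lambda>k. sqrt (1 + (of_int k)\<^sup>2) * norm (a k + b k)) F \<le> M + N" .
qed (use assms H1_le_nonneg in force)

lemma H1_le_uminus: "H1_le a M \<Longrightarrow> H1_le (\<lambda>k. - a k) M"
  by (rule H1_le_dominated) auto

lemma H1_le_diff: "H1_le a M \<Longrightarrow> H1_le b N \<Longrightarrow> H1_le (\<lambda>k. a k - b k) (M + N)"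
  using H1_le_add[OF _ H1_le_uminus, of a M b N] by simp

lemma H1_le_cmult:
  assumes "H1_le a M"
  shows "H1_le (\<lambda>k. c * a k) (norm c * M)"
  unfolding H1_le_def
proof (intro conjI allI impI)
  fix F :: "int set" assume F: "finite F"
  have "(\<Sum>k\<in>F. (1 + (of_int k)\<^sup>2) * (norm (c * a k))\<^sup>2)
      = (norm c)\<^sup>2 * (\<Sum>k\<in>F. (1 + (of_int k)\<^sup>2) * (norm (a k))\<^sup>2)"
    by (simp add: sum_distrib_left norm_mult power_mult_distrib mult_ac)
  also have "\<dots> \<le> (norm c)\<^sup>2 * M\<^sup>2"
    using H1_leD[OF assms F] by (intro mult_left_mono) auto
  finally show "(\<Sum>k\<in>F. (1 + (of_int k)\<^sup>2) * (norm (c * a k))\<^sup>2) \<le> (norm c * M)\<^sup>2"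
    by (simp add: power_mult_distrib)
qed (use assms H1_le_nonneg in force)

lemma H1_le_conj: 
  assumes "H1_le a M"
  shows "H1_le (conj_coeffs a) M"
  unfolding H1_le_def
proof (intro conjI allI impI)
  fix F :: "int set" assume F: "finite F"
  have "(\<Sum>k\<in>F. (1 + (of_int k)\<^sup>2) * (norm (conj_coeffs a k))\<^sup>2)
      = (\<Sum>k\<in>uminus ` F. (1 + (of_int k)\<^sup>2) * (norm (a k))\<^sup>2)"
    by (subst sum.reindex) (auto simp: conj_coeffs_def)
  also have "\<dots> \<le> M\<^sup>2" using assms F by (intro H1_leD) auto
  finally show "(\<Sum>k\<in>F. (1 + (of_int k)\<^sup>2) * (norm (conj_coeffs a k))\<^sup>2) \<le> M\<^sup>2" .
qed (use assms H1_le_nonneg in force)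

lemma H1_le_szego_proj: "H1_le a M \<Longrightarrow> H1_le (szego_proj a) M"
  by (rule H1_le_dominated) (auto simp: szego_proj_def)

lemma summable_inverse_weight: "(\<lambda>k::int. 1 / (1 + (of_int k)\<^sup>2) :: real) summable_on UNIV"
proof -
  have "summable (\<lambda>n. 1 / (1 + (real n)\<^sup>2))"
  proof (rule summable_comparison_test'[of "\<lambda>n. inverse ((real n)\<^sup>2)" 1])
    show "summable (\<lambda>n. inverse ((real n)\<^sup>2))"
      by (rule inverse_power_summable) simp
    show "norm (1 / (1 + (real n)\<^sup>2)) \<le> inverse ((real n)\<^sup>2)" if "n \<ge> 1" for n
    proof -
      have "(real n)\<^sup>2 > 0" using that by simp
      then show ?thesis using frac_le[of 1 1 "(real n)\<^sup>2" "1 + (real n)\<^sup>2"]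
        by (simp add: inverse_eq_divide)
    qed
  qed
  then have nat: "(\<lambda>n. 1 / (1 + (real n)\<^sup>2)) summable_on UNIV"
    by (subst summable_on_UNIV_nonneg_real_iff) auto
  have inj: "inj int" "inj (\<lambda>n. - int n)" by (auto simp: inj_on_def)
  have "(\<lambda>k::int. 1 / (1 + (of_int k)\<^sup>2) :: real) summable_on range int"
    using nat by (simp add: summable_on_reindex[OF inj(1)] comp_def)
  moreover have "(\<lambda>k::int. 1 / (1 + (of_int k)\<^sup>2) :: real) summable_on range (\<lambda>n. - int n)"
    using nat by (simp add: summable_on_reindex[OF inj(2)] comp_def)
  ultimately have "(\<lambda>k::int. 1 / (1 + (of_int k)\<^sup>2) :: real) summable_on range int \<union> range (\<lambda>n. - int n)"
    by (rule summable_on_union)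
  moreover have "range int \<union> range (\<lambda>n. - int n) = UNIV"
  proof -
    have "k \<in> range int \<union> range (\<lambda>n. - int n)" for k
      by (cases k rule: int_cases2) auto
    then show ?thesis by blast
  qed
  ultimately show ?thesis by simp
qed

definition weight_sum :: real where
  "weight_sum = (\<Sum>\<^sub>\<infinity>k::int. 1 / (1 + (of_int k)\<^sup>2))"

lemma sum_inverse_weight_le:
  "finite F \<Longrightarrow> (\<Sum>k\<in>F. 1 / (1 + (of_int k)\<^sup>2)) \<le> weight_sum"
  unfolding weight_sum_def by (rule finite_sum_le_infsum[OF summable_inverse_weight]) auto

lemma weight_sum_ge_1: "1 \<le> weight_sum"
  using sum_inverse_weight_le[of "{0}"] by simp

lemma H1_le_abs_summable:
  assumes "H1_le a M"
  shows "a abs_summable_on UNIV"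
proof (rule Infinite_Sum.abs_summable_on_comparison_test')
  show "(\<lambda>k. 1 / (1 + (of_int k)\<^sup>2) + (1 + (of_int k)\<^sup>2) * (norm (a k))\<^sup>2) summable_on UNIV"
    by (intro summable_on_add summable_inverse_weight H1_le_summable[OF assms])
  fix k
  define w :: real where "w = 1 + (of_int k)\<^sup>2"
  have "w > 0" by (simp add: w_def add_pos_nonneg)
  have "norm (a k) \<le> 2 * norm (a k)" by simp
  also have "\<dots> = 2 * (1 / sqrt w) * (sqrt w * norm (a k))"
    using \<open>w > 0\<close> by simp
  also have "\<dots> \<le> (1 / sqrt w)\<^sup>2 + (sqrt w * norm (a k))\<^sup>2"
    by (rule sum_squares_bound)
  also have "\<dots> = 1 / w + w * (norm (a k))\<^sup>2"
    using \<open>w > 0\<close> by (simp add: power_mult_distrib power_divide)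
  finally show "norm (a k) \<le> 1 / (1 + (of_int k)\<^sup>2) + (1 + (of_int k)\<^sup>2) * (norm (a k))\<^sup>2"
    by (simp add: w_def)
qed

text \<open>\<open>H\<^sup>1\<close> is an algebra because \<open>1 + k\<^sup>2 \<le> 2 (1 + j\<^sup>2) + 2 (1 + (k - j)\<^sup>2)\<close>, so that
  \<open>(1 + k\<^sup>2) / ((1 + j\<^sup>2) (1 + (k - j)\<^sup>2))\<close> is summable in \<open>j\<close> uniformly in \<open>k\<close>.\<close>

lemma weighted_convolution_Cauchy_Schwarz:
  fixes a b :: "int \<Rightarrow> complex" and k :: int
  assumes "finite J"
  shows "(1 + (of_int k)\<^sup>2) * (norm (\<Sum>j\<in>J. a j * b (k - j)))\<^sup>2 \<le>
    4 * weight_sum * (\<Sum>j\<in>J. ((1 + (of_int j)\<^sup>2) * (norm (a j))\<^sup>2)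
        * ((1 + (of_int (k - j))\<^sup>2) * (norm (b (k - j)))\<^sup>2))"
proof -
  define w :: "int \<Rightarrow> real" where "w j = 1 + (of_int j)\<^sup>2" for j
  have w_pos: "w j > 0" for j by (simp add: w_def add_pos_nonneg)
  let ?S = "\<Sum>j\<in>J. (w j * (norm (a j))\<^sup>2) * (w (k - j) * (norm (b (k - j)))\<^sup>2)"
  have "norm (\<Sum>j\<in>J. a j * b (k - j)) \<le> (\<Sum>j\<in>J. norm (a j) * norm (b (k - j)))"
    by (rule order_trans[OF norm_sum]) (simp add: norm_mult)
  also have "\<dots> = (\<Sum>j\<in>J. (1 / sqrt (w j * w (k - j)))
      * (sqrt (w j * w (k - j)) * (norm (a j) * norm (b (k - j)))))"
    using w_pos by (intro sum.cong) (simp_all add: less_imp_neq[symmetric])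
  finally have "(norm (\<Sum>j\<in>J. a j * b (k - j)))\<^sup>2 \<le> (\<Sum>j\<in>J. (1 / sqrt (w j * w (k - j)))
      * (sqrt (w j * w (k - j)) * (norm (a j) * norm (b (k - j)))))\<^sup>2"
    by (rule power_mono) simp
  also have "\<dots> \<le> (\<Sum>j\<in>J. (1 / sqrt (w j * w (k - j)))\<^sup>2)
      * (\<Sum>j\<in>J. (sqrt (w j * w (k - j)) * (norm (a j) * norm (b (k - j))))\<^sup>2)"
    by (rule Cauchy_Schwarz_ineq_sum)
  also have "(\<Sum>j\<in>J. (1 / sqrt (w j * w (k - j)))\<^sup>2) = (\<Sum>j\<in>J. 1 / (w j * w (k - j)))"
    using w_pos by (intro sum.cong) (simp_all add: power_divide less_imp_le)
  also have "(\<Sum>j\<in>J. (sqrt (w j * w (k - j)) * (norm (a j) * norm (b (k - j))))\<^sup>2) = ?S"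
    using w_pos by (intro sum.cong) (simp_all add: power_mult_distrib less_imp_le)
  finally have "w k * (norm (\<Sum>j\<in>J. a j * b (k - j)))\<^sup>2 \<le>
      w k * ((\<Sum>j\<in>J. 1 / (w j * w (k - j))) * ?S)"
    using w_pos[of k] by (intro mult_left_mono) auto
  also have "\<dots> = (\<Sum>j\<in>J. w k / (w j * w (k - j))) * ?S"
  proof -
    have "w k * (\<Sum>j\<in>J. 1 / (w j * w (k - j))) = (\<Sum>j\<in>J. w k / (w j * w (k - j)))"
      by (simp add: sum_distrib_left)
    then show ?thesis by (simp only: mult.assoc[symmetric])
  qed
  also have "\<dots> \<le> (4 * weight_sum) * ?S"
  proof (rule mult_right_mono)
    have "(\<Sum>j\<in>J. w k / (w j * w (k - j))) \<le> (\<Sum>j\<in>J. 2 * (1 / w j) + 2 * (1 / w (k - j)))"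
    proof (rule sum_mono)
      fix j
      have "w k \<le> 2 * w j + 2 * w (k - j)"
        using sum_squares_ge_zero[of "of_int j - (of_int k - of_int j)" 1]
          zero_le_power2[of "2 * of_int j - of_int k :: real"]
        by (simp add: w_def power2_eq_square algebra_simps)
      then have "w k / (w j * w (k - j)) \<le> (2 * w j + 2 * w (k - j)) / (w j * w (k - j))"
        using w_pos by (intro divide_right_mono) (simp_all add: less_imp_le)
      also have "\<dots> = 2 * (1 / w j) + 2 * (1 / w (k - j))"
        using w_pos[of j] w_pos[of "k - j"] by (simp add: field_simps)
      finally show "w k / (w j * w (k - j)) \<le> 2 * (1 / w j) + 2 * (1 / w (k - j))" .
    qed
    also have "\<dots> = 2 * (\<Sum>j\<in>J. 1 / w j) + 2 * (\<Sum>j\<in>J. 1 / w (k - j))"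
      by (simp only: sum.distrib sum_distrib_left)
    also have "(\<Sum>j\<in>J. 1 / w (k - j)) = (\<Sum>i\<in>(\<lambda>j. k - j) ` J. 1 / w i)"
      by (subst sum.reindex) (auto simp: inj_on_def)
    also have "2 * (\<Sum>j\<in>J. 1 / w j) + 2 * (\<Sum>i\<in>(\<lambda>j. k - j) ` J. 1 / w i)
        \<le> 2 * weight_sum + 2 * weight_sum"
      unfolding w_def using assms by (intro add_mono mult_left_mono sum_inverse_weight_le) auto
    finally show "(\<Sum>j\<in>J. w k / (w j * w (k - j))) \<le> 4 * weight_sum" by simp
    show "0 \<le> ?S" using w_pos by (intro sum_nonneg mult_nonneg_nonneg) (simp_all add: less_imp_le)
  qed
  finally show ?thesis by (simp add: w_def)
qed

definition algebra_const :: real where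
  "algebra_const = sqrt (4 * weight_sum)"

lemma algebra_const_ge_1: "1 \<le> algebra_const"
  using weight_sum_ge_1 by (simp add: algebra_const_def)

text \<open>Truncating the inner sum to a finite \<open>J\<close> leaves only finite sums, whose order can be
  exchanged; the bound is uniform in \<open>J\<close> and passes to the limit.\<close>
lemma H1_le_conv:
  assumes a: "H1_le a M" and b: "H1_le b N"
  shows "H1_le (conv a b) (algebra_const * M * N)"
  unfolding H1_le_def
proof (intro conjI allI impI)
  define w :: "int \<Rightarrow> real" where "w j = 1 + (of_int j)\<^sup>2" for j
  have w_pos: "w j > 0" for j by (simp add: w_def add_pos_nonneg)
  have a_sum: "a abs_summable_on UNIV" and b_sum: "b abs_summable_on UNIV"
    using H1_le_abs_summable a b by blast+
  have "(\<lambda>(k, j). a j * b (k - j)) abs_summable_on UNIV \<times> UNIV"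
    using abs_summable_convolution_family[OF a_sum b_sum] by simp
  from Infinite_Sum.abs_summable_on_Sigma_iff[THEN iffD1, OF this]
  have "(\<lambda>j. a j * b (k - j)) abs_summable_on UNIV" for k
    by simp
  then have row: "(\<lambda>j. a j * b (k - j)) summable_on UNIV" for k
    by (rule Infinite_Sum.abs_summable_summable)
  fix F :: "int set" assume F: "finite F"
  let ?B = "4 * weight_sum * (M\<^sup>2 * N\<^sup>2)"
  have fin: "(\<Sum>k\<in>F. w k * (norm (\<Sum>j\<in>J. a j * b (k - j)))\<^sup>2) \<le> ?B" if J: "finite J" for J
  proof -
    have "(\<Sum>k\<in>F. w k * (norm (\<Sum>j\<in>J. a j * b (k - j)))\<^sup>2) \<le>
      (\<Sum>k\<in>F. 4 * weight_sum * (\<Sum>j\<in>J. (w j * (norm (a j))\<^sup>2) * (w (k - j) * (norm (b (k - j)))\<^sup>2)))"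
      unfolding w_def by (intro sum_mono weighted_convolution_Cauchy_Schwarz J)
    also have "\<dots> = 4 * weight_sum * (\<Sum>j\<in>J. (w j * (norm (a j))\<^sup>2) * (\<Sum>k\<in>F. w (k - j) * (norm (b (k - j)))\<^sup>2))"
      unfolding sum_distrib_left by (rule sum.swap)
    also have "\<dots> \<le> 4 * weight_sum * (\<Sum>j\<in>J. (w j * (norm (a j))\<^sup>2) * N\<^sup>2)"
    proof (intro mult_left_mono sum_mono)
      fix j
      have "(\<Sum>k\<in>F. w (k - j) * (norm (b (k - j)))\<^sup>2) = (\<Sum>i\<in>(\<lambda>k. k - j) ` F. w i * (norm (b i))\<^sup>2)"
        by (subst sum.reindex) (auto simp: inj_on_def)
      also have "\<dots> \<le> N\<^sup>2"
        using H1_leD[OF b, of "(\<lambda>k. k - j) ` F"] F by (simp add: w_def)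
      finally show "(\<Sum>k\<in>F. w (k - j) * (norm (b (k - j)))\<^sup>2) \<le> N\<^sup>2" .
      show "0 \<le> w j * (norm (a j))\<^sup>2" using w_pos[of j] by simp
    qed (use weight_sum_ge_1 in auto)
    also have "\<dots> = 4 * weight_sum * ((\<Sum>j\<in>J. w j * (norm (a j))\<^sup>2) * N\<^sup>2)"
      by (simp only: sum_distrib_right)
    also have "\<dots> \<le> ?B"
      using H1_leD[OF a J] weight_sum_ge_1
      by (intro mult_left_mono mult_right_mono) (auto simp: w_def)
    finally show ?thesis .
  qed
  have "((\<lambda>J. \<Sum>k\<in>F. w k * (norm (\<Sum>j\<in>J. a j * b (k - j)))\<^sup>2)
      \<longlongrightarrow> (\<Sum>k\<in>F. w k * (norm (conv a b k))\<^sup>2)) (finite_subsets_at_top UNIV)"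
    unfolding conv_def by (intro tendsto_intros infsum_tendsto row)
  then have "(\<Sum>k\<in>F. w k * (norm (conv a b k))\<^sup>2) \<le> ?B"
    by (rule tendsto_upperbound)
       (auto intro!: eventually_finite_subsets_at_top_weakI fin)
  also have "?B = (algebra_const * M * N)\<^sup>2"
    using weight_sum_ge_1 by (simp add: algebra_const_def power_mult_distrib)
  finally show "(\<Sum>k\<in>F. (1 + (of_int k)\<^sup>2) * (norm (conv a b k))\<^sup>2) \<le> (algebra_const * M * N)\<^sup>2"
    by (simp add: w_def)
next
  show "0 \<le> algebra_const * M * N"
    using algebra_const_ge_1 H1_le_nonneg[OF a] H1_le_nonneg[OF b] by simp
qed

section \<open>The cubic nonlinearity on coefficient sequences\<close>

definition H1_norm :: "(int \<Rightarrow> complex) \<Rightarrow> real" where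
  "H1_norm a = sqrt (\<Sum>\<^sub>\<infinity>k. (1 + (of_int k)\<^sup>2) * (norm (a k))\<^sup>2)"

lemma powr_1_weight: "(1 + (of_int k)\<^sup>2) powr 1 = (1 + (of_int k)\<^sup>2 :: real)"
  by (simp add: add_nonneg_nonneg)

lemma sobolev_norm_1_eq: "sobolev_norm 1 u = H1_norm (fourier_coeff u)"
  by (simp only: sobolev_norm_def H1_norm_def powr_1_weight)

lemma H1_norm_le:
  assumes "H1_le a M"
  shows "H1_norm a \<le> M"
proof -
  have "(\<Sum>\<^sub>\<infinity>k. (1 + (of_int k)\<^sup>2) * (norm (a k))\<^sup>2) \<le> M\<^sup>2"
    using H1_leD[OF assms] by (intro infsum_le_finite_sums H1_le_summable[OF assms]) auto
  then show ?thesis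
    unfolding H1_norm_def using real_le_lsqrt H1_le_nonneg[OF assms] by blast
qed

lemma summable_H1_le_H1_norm:
  assumes "(\<lambda>k. (1 + (of_int k)\<^sup>2) * (norm (a k))\<^sup>2) summable_on UNIV"
  shows "H1_le a (H1_norm a)"
  unfolding H1_le_def
proof (intro conjI allI impI)
  have nonneg: "0 \<le> (\<Sum>\<^sub>\<infinity>k. (1 + (of_int k)\<^sup>2) * (norm (a k))\<^sup>2)"
    by (intro infsum_nonneg) simp
  then show "0 \<le> H1_norm a" by (simp add: H1_norm_def)
  fix F :: "int set" assume "finite F"
  then have "(\<Sum>k\<in>F. (1 + (of_int k)\<^sup>2) * (norm (a k))\<^sup>2) \<le> (\<Sum>\<^sub>\<infinity>k. (1 + (of_int k)\<^sup>2) * (norm (a k))\<^sup>2)"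
    by (intro finite_sum_le_infsum assms) auto
  then show "(\<Sum>k\<in>F. (1 + (of_int k)\<^sup>2) * (norm (a k))\<^sup>2) \<le> (H1_norm a)\<^sup>2"
    using nonneg by (simp add: H1_norm_def)
qed

lemma H1_le_H1_norm: "H1_le a M \<Longrightarrow> H1_le a (H1_norm a)"
  by (rule summable_H1_le_H1_norm) (rule H1_le_summable)

lemma H1_norm_diff_le:
  assumes "H1_le a M" "H1_le b N"
  shows "\<bar>H1_norm a - H1_norm b\<bar> \<le> H1_norm (\<lambda>k. a k - b k)"
proof -
  let ?d = "\<lambda>k. a k - b k"
  have d: "H1_le ?d (H1_norm ?d)"
    using H1_le_diff[OF assms] by (rule H1_le_H1_norm)
  have "H1_le (\<lambda>k. ?d k + b k) (H1_norm ?d + H1_norm b)"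
    by (rule H1_le_add[OF d H1_le_H1_norm[OF assms(2)]])
  then have "H1_norm a \<le> H1_norm ?d + H1_norm b"
    using H1_norm_le by fastforce
  moreover have "H1_le (\<lambda>k. a k - ?d k) (H1_norm a + H1_norm ?d)"
    by (rule H1_le_diff[OF H1_le_H1_norm[OF assms(1)] d])
  then have "H1_norm b \<le> H1_norm a + H1_norm ?d"
    using H1_norm_le by fastforce
  ultimately show ?thesis by linarith
qed

lemma Hs_circle_H1_le:
  assumes "u \<in> Hs_circle 1"
  shows "H1_le (fourier_coeff u) (sobolev_norm 1 u)"
proof -
  have "(\<lambda>k. (1 + (of_int k)\<^sup>2) * (norm (fourier_coeff u k))\<^sup>2) summable_on UNIV"
    using assms unfolding Hs_circle_def powr_1_weight by blast
  then show ?thesis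
    unfolding sobolev_norm_1_eq by (rule summable_H1_le_H1_norm)
qed

text \<open>The Fourier coefficients of \<open>|u|\<^sup>2 u\<close> in terms of those of \<open>u\<close>.\<close>
definition cubic :: "(int \<Rightarrow> complex) \<Rightarrow> int \<Rightarrow> complex" where
  "cubic a = conv (conv a a) (conj_coeffs a)"

lemma cubic_abs_summable:
  assumes "a abs_summable_on UNIV"
  shows "cubic a abs_summable_on UNIV"
  unfolding cubic_def using assms by (intro conv_abs_summable conj_coeffs_abs_summable)

lemma fourier_series_cubic:
  assumes "a abs_summable_on UNIV"
  shows "fourier_series (cubic a) x
    = fourier_series a x * fourier_series a x * cnj (fourier_series a x)"
  unfolding cubic_def
  using assms by (simp add: fourier_series_conv conv_abs_summable conj_coeffs_abs_summable
      fourier_series_conj)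

lemma fourier_coeff_cubic:
  assumes u: "u \<in> L2_circle" and sum: "fourier_coeff u abs_summable_on UNIV"
  shows "fourier_coeff (\<lambda>x. complex_of_real ((norm (u x))\<^sup>2) * u x) = cubic (fourier_coeff u)"
proof
  fix k
  let ?a = "fourier_coeff u"
  have [measurable]: "u \<in> borel_measurable borel"
    using u by (simp add: L2_circle_def)
  have "fourier_coeff (\<lambda>x. complex_of_real ((norm (u x))\<^sup>2) * u x) k
      = fourier_coeff (fourier_series (cubic ?a)) k"
  proof (rule fourier_coeff_cong_AE)
    show "fourier_series (cubic ?a) \<in> borel_measurable borel"
      by (intro fourier_series_measurable cubic_abs_summable sum)
    show "AE x in lborel. x \<in> {0..2 * pi} \<longrightarrow>
        complex_of_real ((norm (u x))\<^sup>2) * u x = fourier_series (cubic ?a) x"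
      using AE_eq_fourier_series[OF u sum]
      by eventually_elim
         (simp add: fourier_series_cubic[OF sum] complex_norm_square del: of_real_power)
  qed measurable
  also have "\<dots> = cubic ?a k"
    by (intro fourier_coeff_fourier_series cubic_abs_summable sum)
  finally show "fourier_coeff (\<lambda>x. complex_of_real ((norm (u x))\<^sup>2) * u x) k = cubic ?a k" .
qed

lemma H1_le_cubic:
  assumes "H1_le a M"
  shows "H1_le (cubic a) (algebra_const\<^sup>2 * M ^ 3)"
proof -
  have "H1_le (cubic a) (algebra_const * (algebra_const * M * M) * M)"
    unfolding cubic_def using assms by (intro H1_le_conv H1_le_conj)
  then show ?thesis by (simp add: power2_eq_square power3_eq_cube mult_ac)
qed

text \<open>With \<open>A = a + w\<close>, the pointwise identity
  \<open>|A|\<^sup>2 A - |a|\<^sup>2 a = w (A + a) cnj A + a\<^sup>2 cnj w\<close> exhibits one factor \<open>w\<close> in each term. The constant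
  \<open>7 = 3 * 2 + 1\<close> bounds the two terms when \<open>w\<close> is no larger than \<open>a\<close>.\<close>
lemma H1_le_cubic_diff:
  assumes a: "H1_le a M" and w: "H1_le w N" and "N \<le> M"
  shows "H1_le (\<lambda>k. cubic (\<lambda>k. a k + w k) k - cubic a k) (7 * algebra_const\<^sup>2 * M\<^sup>2 * N)"
proof -
  define A where "A k = a k + w k" for k
  define D1 where "D1 = conv (conv w (\<lambda>k. A k + a k)) (conj_coeffs A)"
  define D2 where "D2 = conv (conv a a) (conj_coeffs w)"
  have A: "H1_le A (M + N)" unfolding A_def by (rule H1_le_add[OF a w])
  have Aa: "H1_le (\<lambda>k. A k + a k) (M + N + M)" by (rule H1_le_add[OF A a])
  have D1: "H1_le D1 (algebra_const * (algebra_const * N * (M + N + M)) * (M + N))"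
    unfolding D1_def by (intro H1_le_conv H1_le_conj w A Aa)
  have D2: "H1_le D2 (algebra_const * (algebra_const * M * M) * N)"
    unfolding D2_def by (intro H1_le_conv H1_le_conj w a)
  note sums = H1_le_abs_summable[OF a] H1_le_abs_summable[OF w] H1_le_abs_summable[OF A]
    H1_le_abs_summable[OF Aa]
  have D_sums: "D1 abs_summable_on UNIV" "D2 abs_summable_on UNIV"
    using H1_le_abs_summable[OF D1] H1_le_abs_summable[OF D2] by auto
  have "cubic A = (\<lambda>k. (cubic a k + D1 k) + D2 k)"
  proof (rule fourier_series_inject)
    have *: "(\<lambda>k. cubic a k + D1 k) abs_summable_on UNIV"
      using H1_le_abs_summable[OF H1_le_add[OF H1_le_cubic[OF a] D1]] .
    show "(\<lambda>k. (cubic a k + D1 k) + D2 k) abs_summable_on UNIV"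
      using H1_le_abs_summable[OF H1_le_add[OF H1_le_add[OF H1_le_cubic[OF a] D1] D2]] .
    show "fourier_series (cubic A) = fourier_series (\<lambda>k. (cubic a k + D1 k) + D2 k)"
    proof
      fix x
      have A_x: "fourier_series A x = fourier_series a x + fourier_series w x"
        unfolding A_def using sums(1,2) by (rule fourier_series_add)
      have D1_x: "fourier_series D1 x = fourier_series w x
          * (fourier_series A x + fourier_series a x) * cnj (fourier_series A x)"
        unfolding D1_def using sums
        by (simp add: fourier_series_conv conv_abs_summable conj_coeffs_abs_summable
            fourier_series_conj fourier_series_add)
      have D2_x: "fourier_series D2 x = fourier_series a x * fourier_series a x * cnj (fourier_series w x)"
        unfolding D2_def using sums
        by (simp add: fourier_series_conv conv_abs_summable conj_coeffs_abs_summable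
            fourier_series_conj)
      have "fourier_series (\<lambda>k. (cubic a k + D1 k) + D2 k) x
          = fourier_series (cubic a) x + fourier_series D1 x + fourier_series D2 x"
        using fourier_series_add[OF * D_sums(2)]
          fourier_series_add[OF cubic_abs_summable[OF sums(1)] D_sums(1)] by simp
      also have "\<dots> = fourier_series (cubic A) x"
        unfolding fourier_series_cubic[OF sums(1)] fourier_series_cubic[OF sums(3)] D1_x D2_x A_x
        by (simp add: algebra_simps)
      finally show "fourier_series (cubic A) x = fourier_series (\<lambda>k. (cubic a k + D1 k) + D2 k) x" ..
    qed
  qed (rule cubic_abs_summable[OF sums(3)])
  then have "(\<lambda>k. cubic A k - cubic a k) = (\<lambda>k. D1 k + D2 k)" by simp
  then have diff: "H1_le (\<lambda>k. cubic A k - cubic a k)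
      (algebra_const * (algebra_const * N * (M + N + M)) * (M + N) + algebra_const * (algebra_const * M * M) * N)"
    using H1_le_add[OF D1 D2] by simp
  have "0 \<le> M" "0 \<le> N" using a w by (auto dest: H1_le_nonneg)
  have "N * (M + N + M) * (M + N) \<le> N * (3 * M) * (2 * M)"
    using \<open>N \<le> M\<close> \<open>0 \<le> M\<close> \<open>0 \<le> N\<close> by (intro mult_mono) auto
  then have "algebra_const\<^sup>2 * (N * (M + N + M) * (M + N)) \<le> algebra_const\<^sup>2 * (N * (3 * M) * (2 * M))"
    by (rule mult_left_mono) simp
  then have "algebra_const * (algebra_const * N * (M + N + M)) * (M + N) + algebra_const * (algebra_const * M * M) * N
      \<le> 7 * algebra_const\<^sup>2 * M\<^sup>2 * N"
    by (simp add: power2_eq_square algebra_simps)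
  with diff have "H1_le (\<lambda>k. cubic A k - cubic a k) (7 * algebra_const\<^sup>2 * M\<^sup>2 * N)"
    by (rule H1_le_mono)
  then show ?thesis by (simp add: A_def[abs_def])
qed

section \<open>Energy estimate and comparison argument\<close>

lemma weighted_Cauchy_Schwarz:
  "(\<Sum>k\<in>F. (1 + (of_int k)\<^sup>2) * Re (cnj (v k) * y k)) \<le>
   L2_set (\<lambda>k. sqrt (1 + (of_int k)\<^sup>2) * norm (v k)) F * L2_set (\<lambda>k. sqrt (1 + (of_int k)\<^sup>2) * norm (y k)) F"
  for F :: "int set"
proof -
  have "(\<Sum>k\<in>F. (1 + (of_int k)\<^sup>2) * Re (cnj (v k) * y k)) \<le>
      (\<Sum>k\<in>F. \<bar>sqrt (1 + (of_int k)\<^sup>2) * norm (v k)\<bar> * \<bar>sqrt (1 + (of_int k)\<^sup>2) * norm (y k)\<bar>)"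
  proof (rule sum_mono)
    fix k
    have "Re (cnj (v k) * y k) \<le> norm (v k) * norm (y k)"
      using complex_Re_le_cmod[of "cnj (v k) * y k"] by (simp add: norm_mult)
    then have "(1 + (of_int k)\<^sup>2) * Re (cnj (v k) * y k) \<le> (1 + (of_int k)\<^sup>2) * (norm (v k) * norm (y k))"
      by (intro mult_left_mono) auto
    also have "\<dots> = (sqrt (1 + (of_int k)\<^sup>2))\<^sup>2 * (norm (v k) * norm (y k))"
      by (simp add: add_nonneg_nonneg)
    also have "\<dots> = \<bar>sqrt (1 + (of_int k)\<^sup>2) * norm (v k)\<bar> * \<bar>sqrt (1 + (of_int k)\<^sup>2) * norm (y k)\<bar>"
      by (simp add: abs_mult power2_eq_square mult_ac)
    finally show "(1 + (of_int k)\<^sup>2) * Re (cnj (v k) * y k) \<le>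
      \<bar>sqrt (1 + (of_int k)\<^sup>2) * norm (v k)\<bar> * \<bar>sqrt (1 + (of_int k)\<^sup>2) * norm (y k)\<bar>" .
  qed
  also have "\<dots> \<le> L2_set (\<lambda>k. sqrt (1 + (of_int k)\<^sup>2) * norm (v k)) F
      * L2_set (\<lambda>k. sqrt (1 + (of_int k)\<^sup>2) * norm (y k)) F"
    by (rule L2_set_mult_ineq)
  finally show ?thesis .
qed

text \<open>The linear part rotates each mode by a phase and leaves norms unchanged. After undoing this
  rotation, the growth of the norm is bounded by pairing finitely many modes with their own final
  value \<open>\<zeta> t1\<close>, which is held fixed: the pairing \<open>h\<close> is a real function of time whose derivative is
  controlled by the source.\<close>
lemma H1_le_duhamel:
  fixes z F :: "real \<Rightarrow> int \<Rightarrow> complex" and \<mu> :: "int \<Rightarrow> real"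
  assumes le: "t0 \<le> t1"
    and z: "\<And>s k. t0 \<le> s \<Longrightarrow> s \<le> t1 \<Longrightarrow>
      ((\<lambda>r. z r k) has_vector_derivative (\<i> * of_real (\<mu> k) * z s k + F s k)) (at s)"
    and F: "\<And>s. t0 \<le> s \<Longrightarrow> s \<le> t1 \<Longrightarrow> H1_le (F s) (g' s)"
    and g: "\<And>s. t0 \<le> s \<Longrightarrow> s \<le> t1 \<Longrightarrow> (g has_real_derivative g' s) (at s)"
    and z0: "H1_le (z t0) M"
  shows "H1_le (z t1) (M + (g t1 - g t0))"
proof -
  have "g t0 \<le> g t1"
    using g F H1_le_nonneg le by (intro DERIV_nonneg_imp_nondecreasing[OF le]) blast
  have "M \<ge> 0" using z0 by (rule H1_le_nonneg)
  show ?thesis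
    unfolding H1_le_iff_L2_set
  proof (intro conjI allI impI)
    show "0 \<le> M + (g t1 - g t0)" using \<open>g t0 \<le> g t1\<close> \<open>M \<ge> 0\<close> by simp
    fix A :: "int set" assume A: "finite A"
    define N where "N a = L2_set (\<lambda>k. sqrt (1 + (of_int k)\<^sup>2) * norm (a k)) A" for a :: "int \<Rightarrow> complex"
    have N_nonneg: "N a \<ge> 0" for a by (simp add: N_def)
    define \<zeta> where "\<zeta> s k = cis (- (\<mu> k * s)) * z s k" for s k
    define h where "h s = (\<Sum>k\<in>A. (1 + (of_int k)\<^sup>2) * Re (cnj (\<zeta> t1 k) * \<zeta> s k))" for s
    define h' where "h' s = (\<Sum>k\<in>A. (1 + (of_int k)\<^sup>2) * Re (cnj (\<zeta> t1 k) * (cis (- (\<mu> k * s)) * F s k)))" for s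
    have \<zeta>_deriv: "((\<lambda>r. \<zeta> r k) has_vector_derivative cis (- (\<mu> k * s)) * F s k) (at s)"
      if "t0 \<le> s" "s \<le> t1" for s k
    proof -
      have "((\<lambda>r. cis (- (\<mu> k * r))) has_vector_derivative - (\<i> * of_real (\<mu> k)) * cis (- (\<mu> k * s))) (at s)"
        unfolding has_vector_derivative_def
        by (auto intro!: derivative_eq_intros simp: scaleR_conv_of_real algebra_simps)
      from has_vector_derivative_mult[OF this z[OF that, of k]]
      show ?thesis unfolding \<zeta>_def by (simp add: algebra_simps)
    qed
    have h_deriv: "(h has_real_derivative h' s) (at s)" if "t0 \<le> s" "s \<le> t1" for s
    proof -
      have "((\<lambda>r. Re (cnj (\<zeta> t1 k) * \<zeta> r k)) has_real_derivative
          Re (cnj (\<zeta> t1 k) * (cis (- (\<mu> k * s)) * F s k))) (at s)" for k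
      proof -
        have "((\<lambda>r. cnj (\<zeta> t1 k) * \<zeta> r k) has_vector_derivative
            cnj (\<zeta> t1 k) * (cis (- (\<mu> k * s)) * F s k)) (at s)"
          by (rule has_vector_derivative_mult_right[OF \<zeta>_deriv[OF that]])
        then show ?thesis
          unfolding has_real_derivative_iff_has_vector_derivative
          by (rule bounded_linear.has_vector_derivative[OF bounded_linear_Re])
      qed
      then show ?thesis
        unfolding h_def h'_def by (intro DERIV_sum DERIV_cmult)
    qed
    have h'_le: "h' s \<le> N (\<zeta> t1) * g' s" if "t0 \<le> s" "s \<le> t1" for s
    proof -
      have "h' s \<le> N (\<zeta> t1) * N (\<lambda>k. cis (- (\<mu> k * s)) * F s k)"
        unfolding h'_def N_def by (rule weighted_Cauchy_Schwarz)
      also have "N (\<lambda>k. cis (- (\<mu> k * s)) * F s k) = N (F s)"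
        by (simp add: N_def norm_mult)
      also have "N (F s) \<le> g' s"
        using F[OF that] A by (auto simp: H1_le_iff_L2_set N_def)
      finally show ?thesis using N_nonneg by (simp add: mult_left_mono)
    qed
    have "N (\<zeta> t1) * g t0 - h t0 \<le> N (\<zeta> t1) * g t1 - h t1"
    proof (rule DERIV_nonneg_imp_nondecreasing[OF le])
      fix s assume s: "t0 \<le> s" "s \<le> t1"
      have "((\<lambda>s. N (\<zeta> t1) * g s - h s) has_real_derivative N (\<zeta> t1) * g' s - h' s) (at s)"
        by (intro DERIV_diff DERIV_cmult g h_deriv s)
      then show "\<exists>y. ((\<lambda>s. N (\<zeta> t1) * g s - h s) has_real_derivative y) (at s) \<and> 0 \<le> y"
        using h'_le[OF s] by force
    qed
    moreover have "h t0 \<le> N (\<zeta> t1) * M"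
    proof -
      have "h t0 \<le> N (\<zeta> t1) * N (\<zeta> t0)"
        unfolding h_def N_def by (rule weighted_Cauchy_Schwarz)
      also have "N (\<zeta> t0) = N (z t0)"
        by (simp add: N_def \<zeta>_def norm_mult)
      also have "N (\<zeta> t1) * N (z t0) \<le> N (\<zeta> t1) * M"
        using z0 A N_nonneg by (intro mult_left_mono) (auto simp: H1_le_iff_L2_set N_def)
      finally show ?thesis .
    qed
    moreover have "h t1 = (N (\<zeta> t1))\<^sup>2"
    proof -
      have "Re (cnj (\<zeta> t1 k) * \<zeta> t1 k) = (norm (\<zeta> t1 k))\<^sup>2" for k
        unfolding cmod_power2 by (simp add: power2_eq_square)
      then show ?thesis
        unfolding h_def N_def L2_set_def
        by (subst real_sqrt_pow2) (auto intro!: sum_nonneg simp: power_mult_distrib add_nonneg_nonneg)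
    qed
    ultimately have "N (\<zeta> t1) * N (\<zeta> t1) \<le> N (\<zeta> t1) * (M + (g t1 - g t0))"
      by (simp add: power2_eq_square algebra_simps)
    then have "N (\<zeta> t1) \<le> M + (g t1 - g t0)"
      using N_nonneg[of "\<zeta> t1"] \<open>g t0 \<le> g t1\<close> \<open>M \<ge> 0\<close>
      by (cases "N (\<zeta> t1) = 0") (auto simp: mult_le_cancel_left)
    then show "L2_set (\<lambda>k. sqrt (1 + (of_int k)\<^sup>2) * norm (z t1 k)) A \<le> M + (g t1 - g t0)"
      by (simp add: N_def \<zeta>_def norm_mult)
  qed
qed

text \<open>At a first contact time \<open>y\<close> would equal \<open>G\<close> although it lies below \<open>G\<close> up to that time.\<close>
lemma barrier:
  fixes y G :: "real \<Rightarrow> real"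
  assumes cont: "continuous_on {0..T} y" "continuous_on {0..T} G"
    and start: "y 0 < G 0"
    and step: "\<And>t. 0 \<le> t \<Longrightarrow> t \<le> T \<Longrightarrow> (\<And>s. 0 \<le> s \<Longrightarrow> s \<le> t \<Longrightarrow> y s \<le> G s) \<Longrightarrow> y t < G t"
    and t: "0 \<le> t" "t \<le> T"
  shows "y t < G t"
proof (rule ccontr)
  assume "\<not> y t < G t"
  define d where "d s = G s - y s" for s
  have d_cont: "continuous_on {0..T} d"
    unfolding d_def by (intro continuous_intros cont)
  define X where "X = {0..T} \<inter> d -` {..0}"
  have "closed X"
    unfolding X_def by (intro continuous_closed_preimage d_cont closed_atMost closed_atLeastAtMost)
  moreover have "X \<subseteq> {0..T}" by (auto simp: X_def)
  ultimately have "compact X"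
    using compact_Int_closed[of "{0..T}" X] by (simp add: Int_absorb1)
  moreover have "t \<in> X" using \<open>\<not> y t < G t\<close> t by (auto simp: X_def d_def)
  ultimately obtain c where c: "c \<in> X" "\<And>s. s \<in> X \<Longrightarrow> c \<le> s"
    using compact_attains_inf[of X] by blast
  have "0 \<le> c" "c \<le> T" "d c \<le> 0" using c(1) by (auto simp: X_def)
  have "continuous_on {0..c} d"
    using d_cont by (rule continuous_on_subset) (use \<open>c \<le> T\<close> in auto)
  then obtain s where "0 \<le> s" "s \<le> c" "d s = 0"
    using IVT2'[of d c 0 0] \<open>d c \<le> 0\<close> \<open>0 \<le> c\<close> start by (auto simp: d_def)
  then have "s \<in> X" using \<open>c \<le> T\<close> by (auto simp: X_def)
  then have "d c = 0" using c(2) \<open>s \<le> c\<close> \<open>d s = 0\<close> by force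
  have "y s \<le> G s" if "0 \<le> s" "s \<le> c" for s
  proof (cases "s = c")
    case True
    then show ?thesis using \<open>d c = 0\<close> by (simp add: d_def)
  next
    case False
    then have "s \<notin> X" using c(2)[of s] that by force
    then show ?thesis using that \<open>c \<le> T\<close> by (auto simp: X_def d_def)
  qed
  then have "y c < G c" using step \<open>0 \<le> c\<close> \<open>c \<le> T\<close> by blast
  with \<open>d c = 0\<close> show False by (simp add: d_def)
qed

section \<open>Rational functions on the circle\<close>

text \<open>The coefficients of \<open>z * (\<Sum>n. g n * z ^ n)\<close>: a series without constant term.\<close>
definition pos_seq :: "(nat \<Rightarrow> 'a) \<Rightarrow> int \<Rightarrow> 'a::zero" where
  "pos_seq g k = (if k \<le> 0 then 0 else g (nat k - 1))"

lemma pos_seq_has_sum: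
  fixes g :: "nat \<Rightarrow> 'a::{comm_monoid_add, topological_space}"
  assumes "(g has_sum S) UNIV"
  shows "(pos_seq g has_sum S) UNIV"
proof -
  have "(pos_seq g has_sum S) {1..}"
    using assms
    by (subst (asm) has_sum_reindex_bij_witness[of UNIV "\<lambda>k. nat k - 1" "\<lambda>n. int n + 1" "{1..}" "pos_seq g" g S S])
       (auto simp: pos_seq_def nat_add_distrib)
  also have "?this \<longleftrightarrow> ?thesis"
    by (rule has_sum_cong_neutral) (auto simp: pos_seq_def)
  finally show ?thesis .
qed

lemma pos_seq_norm: "norm (pos_seq g k) = pos_seq (\<lambda>n. norm (g n)) k"
  by (simp add: pos_seq_def)

lemma pos_seq_abs_summable:
  fixes g :: "nat \<Rightarrow> complex"
  assumes "summable (\<lambda>n. norm (g n))"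
  shows "pos_seq g abs_summable_on UNIV"
proof -
  have "((\<lambda>n. norm (g n)) has_sum (\<Sum>n. norm (g n))) UNIV"
    using assms by (intro norm_summable_imp_has_sum) (auto intro: summable_sums)
  from pos_seq_has_sum[OF this] show ?thesis
    by (auto simp: pos_seq_norm has_sum_imp_summable)
qed

lemma pos_seq_fourier_series:
  assumes "summable (\<lambda>n. norm (g n))" "(\<lambda>n. g n * cis (real n * x)) sums S"
  shows "fourier_series (pos_seq g) x = cis x * S"
proof -
  have "(\<lambda>n. g n * cis (real n * x) * cis x) sums (S * cis x)"
    using assms(2) by (rule sums_mult2)
  then have "((\<lambda>n. g n * cis (real n * x) * cis x) has_sum (S * cis x)) UNIV"
    using assms(1) by (intro norm_summable_imp_has_sum) (simp_all add: norm_mult)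
  from pos_seq_has_sum[OF this]
  have sum: "(pos_seq (\<lambda>n. g n * cis (real n * x) * cis x) has_sum (S * cis x)) UNIV" .
  have eq: "pos_seq (\<lambda>n. g n * cis (real n * x) * cis x) k = pos_seq g k * cis (of_int k * x)" for k
  proof (cases "k \<le> 0")
    case False
    then have "real (nat k - 1) * x + x = of_int k * x"
      by (simp add: of_nat_diff algebra_simps)
    with False show ?thesis by (simp add: pos_seq_def mult.assoc cis_mult)
  qed (simp add: pos_seq_def)
  have "((\<lambda>k. pos_seq g k * cis (of_int k * x)) has_sum (S * cis x)) UNIV"
    using sum by (simp only: eq[symmetric])
  then show ?thesis by (simp add: fourier_series_def infsumI)
qed

lemma geometric_pos_seq:
  fixes p :: complex
  assumes "norm p < 1"
  shows "pos_seq (\<lambda>n. p ^ n) abs_summable_on UNIV"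
    and "fourier_series (pos_seq (\<lambda>n. p ^ n)) x = cis x / (1 - p * cis x)"
proof -
  have sum: "summable (\<lambda>n. norm (p ^ n))"
    using assms by (simp add: norm_power summable_geometric)
  then show "pos_seq (\<lambda>n. p ^ n) abs_summable_on UNIV" by (rule pos_seq_abs_summable)
  have "norm (p * cis x) < 1" using assms by (simp add: norm_mult)
  then have "(\<lambda>n. (p * cis x) ^ n) sums (1 / (1 - p * cis x))"
    by (rule geometric_sums)
  then have "(\<lambda>n. p ^ n * cis (real n * x)) sums (1 / (1 - p * cis x))"
    by (simp add: power_mult_distrib Complex.DeMoivre)
  from pos_seq_fourier_series[OF sum this]
  show "fourier_series (pos_seq (\<lambda>n. p ^ n)) x = cis x / (1 - p * cis x)" by simp
qed

lemma geometric_deriv_pos_seq: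
  fixes p :: complex
  assumes "norm p < 1"
  shows "pos_seq (\<lambda>n. of_nat n * p ^ (n - 1)) abs_summable_on UNIV"
    and "fourier_series (pos_seq (\<lambda>n. of_nat n * p ^ (n - 1))) x = (cis x / (1 - p * cis x))\<^sup>2"
proof -
  have "summable (\<lambda>n. real (Suc n) * norm p ^ n)"
    using geometric_deriv_sums[of "norm p"] assms by (auto intro: sums_summable)
  then have "summable (\<lambda>n. norm (of_nat (Suc n) * p ^ (Suc n - 1)))"
    by (simp add: norm_mult norm_power del: of_nat_Suc)
  then have sum: "summable (\<lambda>n. norm (of_nat n * p ^ (n - 1)))"
    by (subst (asm) summable_Suc_iff)
  then show "pos_seq (\<lambda>n. of_nat n * p ^ (n - 1)) abs_summable_on UNIV" by (rule pos_seq_abs_summable)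
  have "norm (p * cis x) < 1" using assms by (simp add: norm_mult)
  from sums_mult[OF geometric_deriv_sums[OF this], of "cis x"]
  have "(\<lambda>n. cis x * (of_nat (Suc n) * (p * cis x) ^ n)) sums (cis x * (1 / (1 - p * cis x)\<^sup>2))" .
  moreover have "cis x * (of_nat (Suc n) * (p * cis x) ^ n)
      = of_nat (Suc n) * p ^ (Suc n - 1) * cis (real (Suc n) * x)" for n
    unfolding Complex.DeMoivre[symmetric]
    by (simp only: power_mult_distrib diff_Suc_1 power_Suc mult_ac)
  ultimately have "(\<lambda>n. of_nat (Suc n) * p ^ (Suc n - 1) * cis (real (Suc n) * x))
      sums (cis x * (1 / (1 - p * cis x)\<^sup>2))"
    by (simp only:)
  then have "(\<lambda>n. of_nat n * p ^ (n - 1) * cis (real n * x)) sums (cis x * (1 / (1 - p * cis x)\<^sup>2))"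
    by (subst (asm) sums_Suc_iff) simp
  from pos_seq_fourier_series[OF sum this]
  show "fourier_series (pos_seq (\<lambda>n. of_nat n * p ^ (n - 1))) x = (cis x / (1 - p * cis x))\<^sup>2"
    by (simp add: power_divide power2_eq_square)
qed

text \<open>Used with \<open>m = 2\<close> and \<open>m = 6\<close> to sum \<open>k\<^sup>2 r\<^sup>k\<close> and \<open>k\<^sup>6 r\<^sup>k\<close> with the right power of \<open>1 - r\<close>.\<close>
lemma negative_binomial_sums:
  fixes r :: real
  assumes "0 \<le> r" "r < 1"
  shows "(\<lambda>n. real (n + m choose m) * r ^ n) sums (1 / (1 - r) ^ (m + 1))"
proof -
  have "(\<lambda>n. (- real (m + 1) gchoose n) * (- r) ^ n) sums (1 + - r) powr (- real (m + 1))"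
    using assms by (intro gen_binomial_real) auto
  moreover have "(- real (m + 1) gchoose n) * (- r) ^ n = real (n + m choose m) * r ^ n" for n
  proof -
    have "(- real (m + 1) gchoose n) = (- 1) ^ n * (real (m + n) gchoose n)"
      by (subst gbinomial_minus) (simp add: algebra_simps)
    also have "real (m + n) gchoose n = real (m + n choose n)"
      by (rule binomial_gbinomial[symmetric])
    also have "(m + n choose n) = (n + m choose m)"
      by (subst binomial_symmetric) (auto simp: add.commute)
    finally have "(- real (m + 1) gchoose n) * (- r) ^ n
        = ((- 1) ^ n * (- 1) ^ n) * (real (n + m choose m) * r ^ n)"
      unfolding power_minus[of r] by (simp only: mult_ac)
    moreover have "(- 1) ^ n * (- 1) ^ n = (1 :: real)"
      by (simp flip: power_mult_distrib)
    ultimately show ?thesis by simp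
  qed
  moreover have "(1 + - r) powr (- real (m + 1)) = 1 / (1 - r) ^ (m + 1)"
  proof -
    have "(1 - r) powr (- real (m + 1)) = 1 / (1 - r) powr real (m + 1)"
      by (rule powr_minus_divide)
    also have "(1 - r) powr real (m + 1) = (1 - r) ^ (m + 1)"
      using assms by (intro powr_realpow) simp
    finally show ?thesis by simp
  qed
  ultimately show ?thesis by simp
qed

section \<open>The explicit solution of the cubic Szego equation\<close>

text \<open>The functions \<open>a\<close>, \<open>b\<close>, \<open>p\<close> are the coefficients of the rational solution
  \<open>(a z + b) / (1 - p z) = b + c z / (1 - p z)\<close>. Up to the phases \<open>A\<close> and \<open>E\<close>, \<open>a\<close> is constant, and
  \<open>b\<close> and \<open>p\<close> are linear in \<open>cos (\<omega> t)\<close> and \<open>sin (\<omega> t)\<close>. The factor \<open>1 / \<sigma>\<close> is absorbed into \<open>sn\<close>, so that \<open>\<sigma>\<close>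
  disappears from all formulas and every identity becomes polynomial in \<open>\<delta>\<close>, \<open>sn\<close>, \<open>cs\<close> modulo the
  single relation \<open>cs_sq\<close>. Primed names are time derivatives.\<close>
locale szego_orbit =
  fixes \<delta> :: real
  assumes delta: "0 < \<delta>" "\<delta> < 1"
begin

definition \<sigma> :: real where "\<sigma> = sqrt (4 + \<delta>\<^sup>2)"
definition \<omega> :: real where "\<omega> = \<delta> * \<sigma> / 2"
definition sn :: "real \<Rightarrow> real" where "sn t = sin (\<omega> * t) / \<sigma>"
definition cs :: "real \<Rightarrow> real" where "cs t = cos (\<omega> * t)"
definition A :: "real \<Rightarrow> complex" where "A t = cis (- t)"
definition E :: "real \<Rightarrow> complex" where "E t = cis (- (\<delta>\<^sup>2 / 2) * t)"
definition \<beta> :: "real \<Rightarrow> complex" where "\<beta> t = Complex (\<delta> * cs t) (- ((2 + \<delta>\<^sup>2) * sn t))"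
definition \<beta>' :: "real \<Rightarrow> complex" where
  "\<beta>' t = Complex (- (\<delta>\<^sup>2 / 2 * (4 + \<delta>\<^sup>2) * sn t)) (- (\<delta> * (2 + \<delta>\<^sup>2) / 2 * cs t))"
definition q :: "real \<Rightarrow> complex" where "q t = Complex 0 (- (2 * sn t))"
definition q' :: "real \<Rightarrow> complex" where "q' t = Complex 0 (- (\<delta> * cs t))"

definition a :: "real \<Rightarrow> complex" where "a t = A t * E t * E t"
definition b :: "real \<Rightarrow> complex" where "b t = A t * E t * \<beta> t"
definition p :: "real \<Rightarrow> complex" where "p t = E t * q t"
definition c :: "real \<Rightarrow> complex" where "c t = a t + b t * p t"

definition a' :: "real \<Rightarrow> complex" where "a' t = - \<i> * of_real (1 + \<delta>\<^sup>2) * a t"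
definition b' :: "real \<Rightarrow> complex" where
  "b' t = A t * E t * (- \<i> * of_real (1 + \<delta>\<^sup>2 / 2) * \<beta> t + \<beta>' t)"
definition p' :: "real \<Rightarrow> complex" where
  "p' t = E t * (- \<i> * of_real (\<delta>\<^sup>2 / 2) * q t + q' t)"
definition c' :: "real \<Rightarrow> complex" where "c' t = a' t + b' t * p t + b t * p' t"

definition u :: "real \<Rightarrow> int \<Rightarrow> complex" where
  "u t k = b t * (if k = 0 then 1 else 0) + c t * pos_seq (\<lambda>n. p t ^ n) k"
definition u' :: "real \<Rightarrow> int \<Rightarrow> complex" where
  "u' t k = b' t * (if k = 0 then 1 else 0)
      + (c' t * pos_seq (\<lambda>n. p t ^ n) k + c t * p' t * pos_seq (\<lambda>n. of_nat n * p t ^ (n - 1)) k)"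

lemma sigma_sq: "\<sigma>\<^sup>2 = 4 + \<delta>\<^sup>2" and sigma_ge: "\<sigma> \<ge> 2"
proof -
  show "\<sigma>\<^sup>2 = 4 + \<delta>\<^sup>2" by (simp add: \<sigma>_def add_nonneg_nonneg)
  show "\<sigma> \<ge> 2" unfolding \<sigma>_def by (rule real_le_rsqrt) simp
qed

lemma cs_sq: "(cs t)\<^sup>2 = 1 - (4 + \<delta>\<^sup>2) * (sn t)\<^sup>2"
  using sigma_ge sin_cos_squared_add[of "\<omega> * t"]
  by (simp add: cs_def sn_def power_divide eq_diff_eq flip: sigma_sq)

text \<open>The squared modulus of \<open>p\<close>.\<close>
definition r :: "real \<Rightarrow> real" where "r t = 4 * (sn t)\<^sup>2"

lemma one_minus_r: "1 - r t = (\<delta>\<^sup>2 + 4 * (cs t)\<^sup>2) / (4 + \<delta>\<^sup>2)"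
proof -
  have "4 + \<delta>\<^sup>2 > 0" by (simp add: add_pos_nonneg)
  then show ?thesis
    unfolding cs_sq r_def by (simp add: field_simps)
qed

lemma r_bounds: "0 \<le> r t" "\<delta>\<^sup>2 / 5 \<le> 1 - r t" "r t < 1" "1 - r t \<le> 1"
proof -
  show "0 \<le> r t" by (simp add: r_def)
  then show "1 - r t \<le> 1" by simp
  have "\<delta>\<^sup>2 \<le> 1" using delta by (simp add: power_le_one)
  then have "\<delta>\<^sup>2 / 5 \<le> \<delta>\<^sup>2 / (4 + \<delta>\<^sup>2)"
    by (intro divide_left_mono) (auto simp: add_pos_nonneg)
  also have "\<dots> \<le> 1 - r t"
    unfolding one_minus_r by (intro divide_right_mono) (auto simp: add_pos_nonneg)
  finally show "\<delta>\<^sup>2 / 5 \<le> 1 - r t" .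
  moreover have "\<delta>\<^sup>2 / 5 > 0" using delta by simp
  ultimately show "r t < 1" by linarith
qed

lemma norm_p_sq: "(norm (p t))\<^sup>2 = r t"
proof -
  have "(norm (p t))\<^sup>2 = (norm (q t))\<^sup>2"
    by (simp add: p_def E_def norm_mult)
  then show ?thesis
    unfolding cmod_power2 by (simp add: q_def r_def power_mult_distrib)
qed

lemma norm_p: "norm (p t) < 1"
proof -
  have "(norm (p t))\<^sup>2 < 1\<^sup>2" using norm_p_sq r_bounds by simp
  then show ?thesis by (rule power2_less_imp_less) simp
qed

lemma norm_b_sq: "(norm (b t))\<^sup>2 = \<delta>\<^sup>2 + r t"
proof -
  have "(norm (b t))\<^sup>2 = \<delta>\<^sup>2 * (cs t)\<^sup>2 + ((2 + \<delta>\<^sup>2) * sn t)\<^sup>2"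
  proof -
    have "(norm (b t))\<^sup>2 = (norm (\<beta> t))\<^sup>2"
      by (simp add: b_def E_def A_def norm_mult)
    then show ?thesis
      unfolding cmod_power2 by (simp add: \<beta>_def power_mult_distrib)
  qed
  then show ?thesis unfolding cs_sq r_def by (simp add: power2_eq_square algebra_simps)
qed

text \<open>This is the conservation of the momentum \<open>\<Sum>k. k * |u\<^sub>k|\<^sup>2 = |c|\<^sup>2 / (1 - |p|\<^sup>2)\<^sup>2\<close>, whose initial
  value is \<open>1\<close>.\<close>
lemma norm_c_sq: "(norm (c t))\<^sup>2 = (1 - r t)\<^sup>2"
proof -
  have "c t = A t * E t * E t * (1 + \<beta> t * q t)"
    by (simp add: c_def a_def b_def p_def algebra_simps)
  then have "(norm (c t))\<^sup>2 = (norm (1 + \<beta> t * q t))\<^sup>2"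
    by (simp add: norm_mult A_def E_def)
  also have "\<dots> = (1 - 2 * (2 + \<delta>\<^sup>2) * (sn t)\<^sup>2)\<^sup>2 + 4 * \<delta>\<^sup>2 * (cs t)\<^sup>2 * (sn t)\<^sup>2"
    unfolding cmod_power2 by (simp add: \<beta>_def q_def power2_eq_square algebra_simps)
  also have "\<dots> = (1 - r t)\<^sup>2"
    unfolding cs_sq r_def by (simp add: power2_eq_square algebra_simps)
  finally show ?thesis .
qed

lemma norm_c: "norm (c t) = 1 - r t"
  using norm_c_sq[of t] r_bounds(3)[of t] by (simp add: power2_eq_iff_nonneg)

lemma A_deriv: "(A has_vector_derivative (- \<i> * A t)) (at t)"
  unfolding has_vector_derivative_def A_def
  by (auto intro!: derivative_eq_intros simp: scaleR_conv_of_real algebra_simps)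

lemma E_deriv: "(E has_vector_derivative (- \<i> * of_real (\<delta>\<^sup>2 / 2) * E t)) (at t)"
  unfolding has_vector_derivative_def E_def
  by (auto intro!: derivative_eq_intros simp: scaleR_conv_of_real algebra_simps)

lemma sn_deriv: "(sn has_real_derivative (\<delta> / 2 * cs t)) (at t)"
  unfolding sn_def cs_def using sigma_ge
  by (auto intro!: derivative_eq_intros simp: \<omega>_def field_simps)

lemma cs_deriv: "(cs has_real_derivative (- (\<delta> / 2 * (4 + \<delta>\<^sup>2) * sn t))) (at t)"
  unfolding sn_def cs_def sigma_sq[symmetric] using sigma_ge
  by (auto intro!: derivative_eq_intros simp: \<omega>_def field_simps power2_eq_square)

lemma Complex_deriv:
  assumes "(f has_real_derivative f') (at t)" "(g has_real_derivative g') (at t)"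
  shows "((\<lambda>x. Complex (f x) (g x)) has_vector_derivative Complex f' g') (at t)"
  using assms
  by (simp add: has_vector_derivative_complex_iff has_real_derivative_iff_has_vector_derivative)

lemma beta_deriv: "(\<beta> has_vector_derivative \<beta>' t) (at t)"
proof -
  have "((\<lambda>x. \<delta> * cs x) has_real_derivative (- (\<delta>\<^sup>2 / 2 * (4 + \<delta>\<^sup>2) * sn t))) (at t)"
    using DERIV_cmult[OF cs_deriv, of \<delta>] by (simp add: power2_eq_square algebra_simps)
  moreover have "((\<lambda>x. - ((2 + \<delta>\<^sup>2) * sn x)) has_real_derivative (- (\<delta> * (2 + \<delta>\<^sup>2) / 2 * cs t))) (at t)"
    using DERIV_minus[OF DERIV_cmult[OF sn_deriv, of "2 + \<delta>\<^sup>2"]] by (simp add: algebra_simps)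
  ultimately show ?thesis
    unfolding \<beta>_def[abs_def] \<beta>'_def by (rule Complex_deriv)
qed

lemma q_deriv: "(q has_vector_derivative q' t) (at t)"
proof -
  have "((\<lambda>x. - (2 * sn x)) has_real_derivative (- (\<delta> * cs t))) (at t)"
    using DERIV_minus[OF DERIV_cmult[OF sn_deriv, of 2]] by simp
  then show ?thesis
    unfolding q_def[abs_def] q'_def by (intro Complex_deriv DERIV_const)
qed

lemma a_deriv: "(a has_vector_derivative a' t) (at t)"
  using has_vector_derivative_mult[OF has_vector_derivative_mult[OF A_deriv E_deriv] E_deriv, of t]
  unfolding a_def[abs_def] a'_def by (simp add: algebra_simps)

lemma b_deriv: "(b has_vector_derivative b' t) (at t)"
  using has_vector_derivative_mult[OF has_vector_derivative_mult[OF A_deriv E_deriv] beta_deriv, of t]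
  unfolding b_def[abs_def] b'_def by (simp add: algebra_simps)

lemma p_deriv: "(p has_vector_derivative p' t) (at t)"
  using has_vector_derivative_mult[OF E_deriv q_deriv, of t]
  unfolding p_def[abs_def] p'_def by (simp add: algebra_simps)

lemma c_deriv: "(c has_vector_derivative c' t) (at t)"
  using has_vector_derivative_add[OF a_deriv has_vector_derivative_mult[OF b_deriv p_deriv], of t]
  unfolding c_def[abs_def] c'_def by (simp add: algebra_simps)

lemma p_power_deriv:
  "((\<lambda>s. p s ^ n) has_vector_derivative (p' t * (of_nat n * p t ^ (n - 1)))) (at t)"
proof -
  have "((\<lambda>z. z ^ n) has_field_derivative (of_nat n * p t ^ (n - 1))) (at (p t))"
    by (auto intro!: derivative_eq_intros)
  from field_vector_diff_chain_at[OF p_deriv this]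
  show ?thesis by (simp add: o_def)
qed

lemma u_deriv: "((\<lambda>s. u s k) has_vector_derivative u' t k) (at t)"
proof -
  have "((\<lambda>s. pos_seq (\<lambda>n. p s ^ n) k) has_vector_derivative
      p' t * pos_seq (\<lambda>n. of_nat n * p t ^ (n - 1)) k) (at t)"
    using p_power_deriv[of "nat k - 1" t] by (cases "k \<le> 0") (simp_all add: pos_seq_def)
  note 1 = has_vector_derivative_mult[OF c_deriv this]
  note 2 = has_vector_derivative_mult[OF b_deriv has_vector_derivative_const[of "if k = 0 then 1 else 0"], of t]
  show ?thesis unfolding u_def u'_def
    by (rule has_vector_derivative_eq_rhs[OF has_vector_derivative_add[OF 2 1]]) (simp add: algebra_simps)
qed

lemma cnj_gauge: "A t * cnj (A t) = 1" "E t * cnj (E t) = 1"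
  by (simp_all add: A_def E_def cis_cnj cis_mult)

text \<open>The functions \<open>\<eta>\<close> and \<open>\<kappa>\<close> are \<open>\<i> b'\<close> and \<open>\<i> p'\<close> stripped of their phases; \<open>A t * g t\<close> is the residue
  at \<open>z = cnj p\<close> of \<open>|u|\<^sup>2 u\<close>, continued from the circle as the rational function
  \<open>(a z + b)\<^sup>2 (cnj a + cnj b z) / ((1 - p z)\<^sup>2 (z - cnj p))\<close>.\<close>
definition \<eta> :: "real \<Rightarrow> complex" where "\<eta> t = of_real (1 + \<delta>\<^sup>2 / 2) * \<beta> t + \<i> * \<beta>' t"
definition \<kappa> :: "real \<Rightarrow> complex" where "\<kappa> t = of_real (\<delta>\<^sup>2 / 2) * q t + \<i> * q' t"
definition g :: "real \<Rightarrow> complex" where "g t = (\<beta> t)\<^sup>2 + \<eta> t * cnj (q t)"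

lemma eta_eq: "\<eta> t = Complex (\<delta> * (2 + \<delta>\<^sup>2) * cs t) (- ((2 + 4 * \<delta>\<^sup>2 + \<delta> ^ 4) * sn t))"
  by (simp add: \<eta>_def \<beta>_def \<beta>'_def complex_eq_iff power2_eq_square power4_eq_xxxx field_simps)

lemma kappa_eq: "\<kappa> t = Complex (\<delta> * cs t) (- (\<delta>\<^sup>2 * sn t))"
  by (simp add: \<kappa>_def q_def q'_def complex_eq_iff)

lemma g_eq: "g t = of_real (\<delta>\<^sup>2)"
proof -
  have "g t = of_real (\<delta>\<^sup>2 * (cs t)\<^sup>2 + \<delta>\<^sup>2 * (4 + \<delta>\<^sup>2) * (sn t)\<^sup>2)"
    by (simp add: g_def eta_eq \<beta>_def q_def complex_eq_iff power2_eq_square power4_eq_xxxx algebra_simps)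
  then show ?thesis by (simp only: cs_sq) (simp add: algebra_simps)
qed

text \<open>The coefficients of \<open>y\<^sup>3\<close>, \<open>y\<^sup>2\<close> and \<open>y\<close> in the polynomial identity below, the second one
  simplified by means of the first; the constant coefficient is the definition of \<open>g\<close>.\<close>
lemma orbit_coeff_3: "- (of_real (1 + \<delta>\<^sup>2) * q t) + \<kappa> t = cnj (\<beta> t)"
  by (simp add: kappa_eq \<beta>_def q_def complex_eq_iff algebra_simps)

lemma orbit_coeff_2:
  "- (cnj (q t) * cnj (\<beta> t)) + of_real (1 + \<delta>\<^sup>2) - \<eta> t * q t + \<beta> t * \<kappa> t + g t * (q t)\<^sup>2
    = 1 + 2 * \<beta> t * cnj (\<beta> t)" (is "?L = ?R")
proof (rule complex_eqI)
  show "Re ?L = Re ?R"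
    using cs_sq[of t]
    by (simp add: kappa_eq eta_eq g_eq \<beta>_def q_def power2_eq_square power4_eq_xxxx) (simp add: algebra_simps)
  show "Im ?L = Im ?R"
    by (simp add: kappa_eq eta_eq g_eq \<beta>_def q_def power2_eq_square power4_eq_xxxx algebra_simps)
qed

lemma orbit_coeff_1:
  "- ((of_real (1 + \<delta>\<^sup>2) - \<eta> t * q t + \<beta> t * \<kappa> t) * cnj (q t)) + \<eta> t - 2 * g t * q t
    = 2 * \<beta> t + (\<beta> t)\<^sup>2 * cnj (\<beta> t)" (is "?L = ?R")
proof (rule complex_eqI)
  show "Re ?L = Re ?R"
    using cs_sq[of t]
    by (simp add: kappa_eq eta_eq g_eq \<beta>_def q_def power2_eq_square power4_eq_xxxx) algebra
  show "Im ?L = Im ?R"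
    using cs_sq[of t]
    by (simp add: kappa_eq eta_eq g_eq \<beta>_def q_def power2_eq_square power4_eq_xxxx) algebra
qed

lemma orbit_polynomial_gauged:
  "((of_real (1 + \<delta>\<^sup>2) * y + \<eta> t) * (1 - q t * y) + (y + \<beta> t) * \<kappa> t * y) * (y - cnj (q t))
     + g t * (1 - q t * y)\<^sup>2 = (y + \<beta> t)\<^sup>2 * (1 + cnj (\<beta> t) * y)"
  using orbit_coeff_1[of t] orbit_coeff_2[of t] orbit_coeff_3[of t] g_def[of t] by algebra

text \<open>The variable \<open>y = E t * z\<close> removes the phases.\<close>
lemma orbit_polynomial:
  "\<i> * ((a' t * z + b' t) * (1 - p t * z) + (a t * z + b t) * p' t * z) * (z - cnj (p t))
     + A t * g t * (1 - p t * z)\<^sup>2 = (a t * z + b t)\<^sup>2 * (cnj (a t) + cnj (b t) * z)"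
proof -
  define y where "y = E t * z"
  have ia: "\<i> * a' t = of_real (1 + \<delta>\<^sup>2) * a t"
    by (simp add: a'_def algebra_simps)
  have ib: "\<i> * b' t = A t * E t * \<eta> t"
    by (simp add: b'_def \<eta>_def algebra_simps)
  have ip: "\<i> * p' t = E t * \<kappa> t"
    by (simp add: p'_def \<kappa>_def algebra_simps)
  have 1: "a t * z + b t = A t * E t * (y + \<beta> t)"
    by (simp add: a_def b_def y_def algebra_simps)
  have 2: "p t * z = q t * y"
    by (simp add: p_def y_def)
  have 3: "z - cnj (p t) = cnj (E t) * (y - cnj (q t))"
    using cnj_gauge(2)[of t] by (simp add: p_def y_def algebra_simps)
  have 4: "cnj (a t) + cnj (b t) * z = cnj (A t) * cnj (E t) * cnj (E t) * (1 + cnj (\<beta> t) * y)"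
    using cnj_gauge(2)[of t] by (simp add: a_def b_def y_def algebra_simps)
  have "\<i> * ((a' t * z + b' t) * (1 - p t * z) + (a t * z + b t) * p' t * z)
      = (\<i> * a' t * z + \<i> * b' t) * (1 - p t * z) + (a t * z + b t) * (\<i> * p' t) * z"
    by (simp add: algebra_simps)
  also have "\<dots> = A t * E t * ((of_real (1 + \<delta>\<^sup>2) * y + \<eta> t) * (1 - q t * y) + (y + \<beta> t) * \<kappa> t * y)"
    unfolding ia ib ip 1 2 by (simp add: a_def y_def algebra_simps)
  finally have 5: "\<i> * ((a' t * z + b' t) * (1 - p t * z) + (a t * z + b t) * p' t * z)
      = A t * E t * ((of_real (1 + \<delta>\<^sup>2) * y + \<eta> t) * (1 - q t * y) + (y + \<beta> t) * \<kappa> t * y)" .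
  show ?thesis
    unfolding 5 unfolding 1 2 3 4
    using orbit_polynomial_gauged[of y t] cnj_gauge[of t] by algebra
qed

end

lemma dirac_abs_summable: "(\<lambda>k::int. if k = 0 then 1 else 0 :: complex) abs_summable_on UNIV"
  by (rule finite_nonzero_values_imp_summable_on) simp

lemma dirac_fourier_series: "fourier_series (\<lambda>k. if k = 0 then 1 else 0) x = 1"
  unfolding fourier_series_def
  by (rule infsumI, rule has_sum_finite_neutralI[of "{0}"]) auto

lemma abs_summable_add:
  fixes a b :: "int \<Rightarrow> complex"
  assumes "a abs_summable_on UNIV" "b abs_summable_on UNIV"
  shows "(\<lambda>k. a k + b k) abs_summable_on UNIV"
  by (rule Infinite_Sum.abs_summable_on_comparison_test'[OF summable_on_add[OF assms]]) (rule norm_triangle_ineq)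

lemma abs_summable_cmult:
  fixes a :: "int \<Rightarrow> complex"
  assumes "a abs_summable_on UNIV"
  shows "(\<lambda>k. c * a k) abs_summable_on UNIV"
  unfolding norm_mult using assms by (rule summable_on_cmult_right)

context szego_orbit
begin

lemma u_fourier_series:
  "u t abs_summable_on UNIV"
  "fourier_series (u t) x = b t + c t * (cis x / (1 - p t * cis x))"
proof -
  note P = geometric_pos_seq[OF norm_p[of t]]
  note sums = abs_summable_cmult[OF dirac_abs_summable, of "b t"] abs_summable_cmult[OF P(1), of "c t"]
  show "u t abs_summable_on UNIV"
    unfolding u_def[abs_def] by (rule abs_summable_add[OF sums])
  show "fourier_series (u t) x = b t + c t * (cis x / (1 - p t * cis x))"
    unfolding u_def[abs_def] fourier_series_add[OF sums] fourier_series_cmult P(2) dirac_fourier_series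
    by simp
qed

lemma u'_fourier_series:
  "u' t abs_summable_on UNIV"
  "fourier_series (u' t) x = b' t + (c' t * (cis x / (1 - p t * cis x))
      + c t * p' t * (cis x / (1 - p t * cis x))\<^sup>2)"
proof -
  note P = geometric_pos_seq[OF norm_p[of t]]
  note Q = geometric_deriv_pos_seq[OF norm_p[of t]]
  note sums = abs_summable_cmult[OF dirac_abs_summable, of "b' t"] abs_summable_cmult[OF P(1), of "c' t"]
    abs_summable_cmult[OF Q(1), of "c t * p' t"]
  note sums' = sums(1) abs_summable_add[OF sums(2,3)]
  show "u' t abs_summable_on UNIV"
    unfolding u'_def[abs_def] by (rule abs_summable_add[OF sums'])
  show "fourier_series (u' t) x = b' t + (c' t * (cis x / (1 - p t * cis x))
      + c t * p' t * (cis x / (1 - p t * cis x))\<^sup>2)"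
    unfolding u'_def[abs_def] fourier_series_add[OF sums'] fourier_series_add[OF sums(2,3)]
      fourier_series_cmult P(2) Q(2) dirac_fourier_series
    by simp
qed

lemma one_minus_p_cis_nonzero: "1 - p t * cis x \<noteq> 0"
proof
  assume "1 - p t * cis x = 0"
  then have "norm (p t * cis x) = 1" by (simp add: algebra_simps)
  then show False using norm_p[of t] by (simp add: norm_mult)
qed

text \<open>On the circle \<open>cnj z = 1 / z\<close>, so both sides are rational in \<open>z\<close>, and the claim is
  \<open>orbit_polynomial\<close> divided by \<open>(1 - p z)\<^sup>2 (z - cnj p)\<close>.\<close>
lemma orbit_pointwise:
  fixes t x :: real
  defines "P \<equiv> \<lambda>x. cis x / (1 - p t * cis x)"
  shows "\<i> * (b' t + (c' t * P x + c t * p' t * (P x)\<^sup>2)) + A t * g t * cnj (P x)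
     = (b t + c t * P x) * (b t + c t * P x) * cnj (b t + c t * P x)"
proof -
  define z where "z = cis x"
  have zz: "z * cnj z = 1" by (simp add: z_def cis_cnj cis_mult)
  then have z_ne: "z \<noteq> 0" by auto
  define Z where "Z = 1 - p t * z"
  define V where "V = z - cnj (p t)"
  have Z_ne: "Z \<noteq> 0" unfolding Z_def z_def by (rule one_minus_p_cis_nonzero)
  have V_eq: "V = z * cnj Z"
    unfolding V_def Z_def using zz by (simp add: algebra_simps)
  have V_ne: "V \<noteq> 0" using V_eq z_ne Z_ne by simp
  have P: "P x = z / Z" by (simp add: P_def z_def Z_def)
  have "cnj (P x) = z * cnj z / (z * cnj Z)"
    unfolding P using z_ne by simp
  then have cnj_P: "cnj (P x) = 1 / V" unfolding zz V_eq .
  have U: "b t + c t * P x = (a t * z + b t) / Z"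
    unfolding P using Z_ne by (simp add: c_def Z_def field_simps)
  have cnj_U: "cnj (b t + c t * P x) = (cnj (a t) + cnj (b t) * z) / V"
  proof -
    have "cnj (b t + c t * P x) = z * (cnj (a t) * cnj z + cnj (b t)) / (z * cnj Z)"
      unfolding U using z_ne by simp
    also have "z * (cnj (a t) * cnj z + cnj (b t)) = cnj (a t) + cnj (b t) * z"
      using zz by (simp add: algebra_simps)
    finally show ?thesis unfolding V_eq .
  qed
  have dU: "b' t + (c' t * P x + c t * p' t * (P x)\<^sup>2)
      = ((a' t * z + b' t) * (1 - p t * z) + (a t * z + b t) * p' t * z) / Z\<^sup>2"
  proof -
    have "b' t + (c' t * P x + c t * p' t * (P x)\<^sup>2) = (b' t * Z\<^sup>2 + c' t * z * Z + c t * p' t * z\<^sup>2) / Z\<^sup>2"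
      unfolding P using Z_ne by (simp add: field_simps power2_eq_square)
    also have "b' t * Z\<^sup>2 + c' t * z * Z + c t * p' t * z\<^sup>2
        = (a' t * z + b' t) * (1 - p t * z) + (a t * z + b t) * p' t * z"
      by (simp add: c_def c'_def Z_def power2_eq_square algebra_simps)
    finally show ?thesis .
  qed
  define N where "N = \<i> * ((a' t * z + b' t) * (1 - p t * z) + (a t * z + b t) * p' t * z)"
  have poly: "N * V + A t * g t * Z\<^sup>2 = (a t * z + b t)\<^sup>2 * (cnj (a t) + cnj (b t) * z)"
    unfolding N_def V_def Z_def by (rule orbit_polynomial)
  have "\<i> * (b' t + (c' t * P x + c t * p' t * (P x)\<^sup>2)) + A t * g t * cnj (P x)
      = N / Z\<^sup>2 + A t * g t / V"
    unfolding dU cnj_P N_def by simp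
  also have "\<dots> = (N * V + A t * g t * Z\<^sup>2) / (Z\<^sup>2 * V)"
    using Z_ne V_ne by (simp add: field_simps)
  also have "\<dots> = (a t * z + b t) / Z * ((a t * z + b t) / Z) * ((cnj (a t) + cnj (b t) * z) / V)"
    unfolding poly by (simp add: power2_eq_square)
  finally show ?thesis unfolding cnj_U unfolding U .
qed

text \<open>The term with the pole at \<open>cnj p\<close>, inside the disc, has only negative frequencies, so it is
  what the projector removes.\<close>
lemma szego_equation:
  assumes "k \<ge> 0"
  shows "\<i> * u' t k = cubic (u t) k"
proof -
  note P = geometric_pos_seq[OF norm_p[of t]]
  define d where "d = conj_coeffs (pos_seq (\<lambda>n. p t ^ n))"
  have d_sum: "d abs_summable_on UNIV"
    unfolding d_def by (rule conj_coeffs_abs_summable[OF P(1)])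
  note sums = abs_summable_cmult[OF u'_fourier_series(1), of \<i> t] abs_summable_cmult[OF d_sum, of "A t * g t"]
  have "(\<lambda>k. \<i> * u' t k + A t * g t * d k) = cubic (u t)"
  proof (rule fourier_series_inject)
    show "(\<lambda>k. \<i> * u' t k + A t * g t * d k) abs_summable_on UNIV"
      by (rule abs_summable_add[OF sums])
    show "cubic (u t) abs_summable_on UNIV"
      by (rule cubic_abs_summable[OF u_fourier_series(1)])
    show "fourier_series (\<lambda>k. \<i> * u' t k + A t * g t * d k) = fourier_series (cubic (u t))"
    proof
      fix x
      have "fourier_series d x = cnj (cis x / (1 - p t * cis x))"
        unfolding d_def fourier_series_conj P(2) ..
      then show "fourier_series (\<lambda>k. \<i> * u' t k + A t * g t * d k) x = fourier_series (cubic (u t)) x"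
        unfolding fourier_series_add[OF sums] fourier_series_cmult
          fourier_series_cubic[OF u_fourier_series(1)] u_fourier_series(2) u'_fourier_series(2)
        by (simp only: orbit_pointwise)
    qed
  qed
  moreover have "d k = 0" using assms by (simp add: d_def conj_coeffs_def pos_seq_def)
  ultimately show ?thesis by (metis add.right_neutral mult_zero_right)
qed

section \<open>Sobolev norms of the explicit solution\<close>

lemma negative_binomial_pos_seq:
  "(pos_seq (\<lambda>n. real (n + m choose m) * r t ^ n) has_sum (1 / (1 - r t) ^ (m + 1))) UNIV"
proof (rule pos_seq_has_sum)
  show "((\<lambda>n. real (n + m choose m) * r t ^ n) has_sum (1 / (1 - r t) ^ (m + 1))) UNIV"
    using r_bounds(1,3) by (intro sums_nonneg_imp_has_sum negative_binomial_sums) auto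
qed

lemma norm_u_sq:
  "(norm (u t k))\<^sup>2 = (if k = 0 then \<delta>\<^sup>2 + r t else 0) + (1 - r t)\<^sup>2 * pos_seq (\<lambda>n. r t ^ n) k"
proof (cases "k > 0")
  case True
  have "(norm (p t ^ (nat k - 1)))\<^sup>2 = r t ^ (nat k - 1)"
    unfolding norm_p_sq[symmetric] by (simp add: norm_power power_mult[symmetric] mult.commute)
  with True show ?thesis
    by (simp add: u_def pos_seq_def norm_mult power_mult_distrib norm_c)
next
  case False
  then show ?thesis by (simp add: u_def pos_seq_def norm_b_sq)
qed

lemma power_quotients:
  fixes x :: real
  assumes "x \<noteq> 0"
  shows "x\<^sup>2 * (1 / x ^ (2 + 1)) = 1 / x" "x\<^sup>2 * (1 / x ^ (6 + 1)) = (1 / x) ^ 5"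
  using assms by (simp_all add: field_simps eval_nat_numeral)

lemma choose_2: "real (n + 2 choose 2) = (real n + 1) * (real n + 2) / 2"
proof -
  have "even ((n + 2) * (n + 1))" by simp
  then show ?thesis
    by (simp add: choose_two real_of_nat_div algebra_simps)
qed

lemma u_negative: "k < 0 \<Longrightarrow> u t k = 0"
  by (simp add: u_def pos_seq_def)

lemma u'_negative: "k < 0 \<Longrightarrow> u' t k = 0"
  by (simp add: u'_def pos_seq_def)

text \<open>The momentum identity gives \<open>|u\<^sub>k|\<^sup>2 = (1 - r)\<^sup>2 r\<^sup>k\<^sup>-\<^sup>1\<close>, and \<open>\<Sum>k. k\<^sup>2 r\<^sup>k\<^sup>-\<^sup>1\<close> is of order
  \<open>(1 - r)\<^sup>-\<^sup>3\<close>. The weights are compared with \<open>(k + 1) choose 2\<close>, for which the sum is exact.\<close>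
lemma u_H1_le: "H1_le (u t) (sqrt (6 / (1 - r t)))"
  unfolding H1_le_def
proof (intro conjI allI impI)
  show "0 \<le> sqrt (6 / (1 - r t))" using r_bounds(3)[of t] by simp
  fix F :: "int set" assume F: "finite F"
  let ?\<rho> = "1 - r t"
  have \<rho>: "0 < ?\<rho>" "?\<rho> \<le> 1" using r_bounds(3,4)[of t] by auto
  let ?g = "pos_seq (\<lambda>n. real (n + 2 choose 2) * r t ^ n)"
  have "(\<Sum>k\<in>F. (1 + (of_int k)\<^sup>2) * (norm (u t k))\<^sup>2)
      \<le> (\<Sum>k\<in>F. (if k = 0 then \<delta>\<^sup>2 + r t else 0) + 4 * ?\<rho>\<^sup>2 * ?g k)"
  proof (rule sum_mono)
    fix k
    show "(1 + (of_int k)\<^sup>2) * (norm (u t k))\<^sup>2 \<le> (if k = 0 then \<delta>\<^sup>2 + r t else 0) + 4 * ?\<rho>\<^sup>2 * ?g k"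
    proof (cases "k > 0")
      case True
      define n where "n = nat k - 1"
      have k: "real_of_int k = real n + 1" using True by (simp add: n_def of_nat_diff)
      have "1 + (real_of_int k)\<^sup>2 \<le> 4 * real (n + 2 choose 2)"
        unfolding k choose_2 by (simp add: power2_eq_square field_simps)
      then have "(1 + (real_of_int k)\<^sup>2) * (?\<rho>\<^sup>2 * r t ^ n) \<le> 4 * real (n + 2 choose 2) * (?\<rho>\<^sup>2 * r t ^ n)"
        using r_bounds(1) by (intro mult_right_mono) auto
      with True show ?thesis by (simp add: norm_u_sq pos_seq_def n_def mult_ac)
    qed (auto simp: norm_u_sq pos_seq_def)
  qed
  also have "\<dots> = (\<Sum>k\<in>F. if k = 0 then \<delta>\<^sup>2 + r t else 0) + 4 * ?\<rho>\<^sup>2 * (\<Sum>k\<in>F. ?g k)"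
    by (simp only: sum.distrib sum_distrib_left)
  also have "\<dots> \<le> 2 + 4 * ?\<rho>\<^sup>2 * (1 / ?\<rho> ^ (2 + 1))"
  proof (intro add_mono mult_left_mono)
    have "\<delta>\<^sup>2 \<le> 1" using delta by (simp add: power_le_one)
    then show "(\<Sum>k\<in>F. if k = 0 then \<delta>\<^sup>2 + r t else 0) \<le> 2"
      using F r_bounds(3)[of t] by (simp add: sum.delta)
    have "0 \<le> ?g k" for k using r_bounds(1) by (simp add: pos_seq_def)
    then show "(\<Sum>k\<in>F. ?g k) \<le> 1 / ?\<rho> ^ (2 + 1)"
      using F by (intro finite_sum_le_has_sum[OF negative_binomial_pos_seq]) auto
  qed auto
  also have "\<dots> = 2 + 4 / ?\<rho>" using \<rho> power_quotients(1)[of ?\<rho>] by (simp add: mult.assoc)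
  also have "\<dots> \<le> 2 / ?\<rho> + 4 / ?\<rho>"
    using \<rho> by (intro add_mono) (simp_all add: le_divide_eq)
  also have "\<dots> = 6 / ?\<rho>" by (simp flip: add_divide_distrib)
  also have "\<dots> = (sqrt (6 / ?\<rho>))\<^sup>2" using \<rho> by simp
  finally show "(\<Sum>k\<in>F. (1 + (of_int k)\<^sup>2) * (norm (u t k))\<^sup>2) \<le> (sqrt (6 / ?\<rho>))\<^sup>2" .
qed

lemma u_H1_norm_ge: "1 / sqrt (1 - r t) \<le> H1_norm (u t)"
proof -
  let ?\<rho> = "1 - r t"
  have \<rho>: "0 < ?\<rho>" using r_bounds(3)[of t] by auto
  let ?M = "H1_norm (u t)"
  have M: "H1_le (u t) ?M" using u_H1_le by (rule H1_le_H1_norm)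
  let ?g = "pos_seq (\<lambda>n. real (n + 2 choose 2) * r t ^ n)"
  have "((\<lambda>k. ?\<rho>\<^sup>2 * ?g k) has_sum (?\<rho>\<^sup>2 * (1 / ?\<rho> ^ (2 + 1)))) UNIV"
    by (intro has_sum_cmult_right negative_binomial_pos_seq)
  then have "?\<rho>\<^sup>2 * (1 / ?\<rho> ^ (2 + 1)) \<le> ?M\<^sup>2"
  proof (rule has_sum_le_finite_sums)
    fix F :: "int set" assume F: "finite F"
    have "(\<Sum>k\<in>F. ?\<rho>\<^sup>2 * ?g k) \<le> (\<Sum>k\<in>F. (1 + (of_int k)\<^sup>2) * (norm (u t k))\<^sup>2)"
    proof (rule sum_mono)
      fix k
      show "?\<rho>\<^sup>2 * ?g k \<le> (1 + (of_int k)\<^sup>2) * (norm (u t k))\<^sup>2"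
      proof (cases "k > 0")
        case True
        define n where "n = nat k - 1"
        have k: "real_of_int k = real n + 1" using True by (simp add: n_def of_nat_diff)
        have "real (n + 2 choose 2) \<le> 1 + (real_of_int k)\<^sup>2"
          unfolding k choose_2 by (simp add: power2_eq_square field_simps)
        then have "real (n + 2 choose 2) * (?\<rho>\<^sup>2 * r t ^ n) \<le> (1 + (real_of_int k)\<^sup>2) * (?\<rho>\<^sup>2 * r t ^ n)"
          using r_bounds(1) by (intro mult_right_mono) auto
        with True show ?thesis by (simp add: norm_u_sq pos_seq_def n_def mult_ac)
      qed (simp add: pos_seq_def)
    qed
    also have "\<dots> \<le> ?M\<^sup>2" using M F by (rule H1_leD)
    finally show "(\<Sum>k\<in>F. ?\<rho>\<^sup>2 * ?g k) \<le> ?M\<^sup>2" .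
  qed
  also have "?\<rho>\<^sup>2 * (1 / ?\<rho> ^ (2 + 1)) = (1 / sqrt ?\<rho>)\<^sup>2"
    using \<rho> power_quotients(1)[of ?\<rho>] by (simp add: power_divide)
  finally show ?thesis
    using H1_le_nonneg[OF M] by (rule power2_le_imp_le)
qed

text \<open>Only polynomial growth in \<open>1 / \<delta>\<close> matters here, as this bound is multiplied by the
  exponentially small \<open>\<nu>\<^sup>2\<close>; the comparison \<open>k\<^sup>6 \<le> 6\<^sup>6 * ((k + 5) choose 6)\<close> is crude.\<close>
lemma dxx_u_H1_le: "H1_le (dxx (u t)) (20000 / \<delta> ^ 5)"
  unfolding H1_le_def
proof (intro conjI allI impI)
  show "0 \<le> 20000 / \<delta> ^ 5" using delta by simp
  fix F :: "int set" assume F: "finite F"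
  let ?\<rho> = "1 - r t"
  have \<rho>: "0 < ?\<rho>" using r_bounds(3)[of t] by auto
  let ?g = "pos_seq (\<lambda>n. real (n + 6 choose 6) * r t ^ n)"
  have "(\<Sum>k\<in>F. (1 + (of_int k)\<^sup>2) * (norm (dxx (u t) k))\<^sup>2) \<le> (\<Sum>k\<in>F. 2 * 6 ^ 6 * ?\<rho>\<^sup>2 * ?g k)"
  proof (rule sum_mono)
    fix k
    show "(1 + (of_int k)\<^sup>2) * (norm (dxx (u t) k))\<^sup>2 \<le> 2 * 6 ^ 6 * ?\<rho>\<^sup>2 * ?g k"
    proof (cases "k > 0")
      case True
      define n where "n = nat k - 1"
      have k: "real_of_int k = real n + 1" using True by (simp add: n_def of_nat_diff)
      have "(real n + 1) ^ 6 \<le> (real (n + 6)) ^ 6" by (intro power_mono) auto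
      also have "\<dots> = 6 ^ 6 * (real (n + 6) / real 6) ^ 6"
        by (simp add: power_divide)
      also have "\<dots> \<le> 6 ^ 6 * real (n + 6 choose 6)"
        using binomial_ge_n_over_k_pow_k[of 6 "n + 6", where 'a = real] by (intro mult_left_mono) auto
      finally have k6: "(real_of_int k) ^ 6 \<le> 6 ^ 6 * real (n + 6 choose 6)" by (simp only: k)
      have "1 \<le> (real_of_int k)\<^sup>2" using True by simp
      then have "(1 + (real_of_int k)\<^sup>2) * (real_of_int k) ^ 4 \<le> (2 * (real_of_int k)\<^sup>2) * (real_of_int k) ^ 4"
        by (intro mult_right_mono) auto
      also have "\<dots> = 2 * (real_of_int k) ^ 6" by (simp add: power_add[symmetric])
      also have "\<dots> \<le> 2 * 6 ^ 6 * real (n + 6 choose 6)" using k6 by simp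
      finally have "(1 + (real_of_int k)\<^sup>2) * (real_of_int k) ^ 4 * (?\<rho>\<^sup>2 * r t ^ n)
          \<le> 2 * 6 ^ 6 * real (n + 6 choose 6) * (?\<rho>\<^sup>2 * r t ^ n)"
        using r_bounds(1) by (intro mult_right_mono) auto
      moreover have "(norm (dxx (u t) k))\<^sup>2 = (real_of_int k) ^ 4 * (norm (u t k))\<^sup>2"
        by (simp add: dxx_def norm_mult norm_power power_mult_distrib power_mult[symmetric])
      ultimately show ?thesis using True by (simp add: norm_u_sq pos_seq_def n_def mult_ac)
    next
      case False
      then have "dxx (u t) k = 0" by (cases "k = 0") (auto simp: dxx_def u_negative)
      with False show ?thesis by (simp add: pos_seq_def)
    qed
  qed
  also have "\<dots> = 2 * 6 ^ 6 * ?\<rho>\<^sup>2 * (\<Sum>k\<in>F. ?g k)"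
    by (simp only: sum_distrib_left)
  also have "\<dots> \<le> 2 * 6 ^ 6 * ?\<rho>\<^sup>2 * (1 / ?\<rho> ^ (6 + 1))"
  proof (rule mult_left_mono)
    have "0 \<le> ?g k" for k using r_bounds(1) by (simp add: pos_seq_def)
    then show "(\<Sum>k\<in>F. ?g k) \<le> 1 / ?\<rho> ^ (6 + 1)"
      using F by (intro finite_sum_le_has_sum[OF negative_binomial_pos_seq]) auto
  qed auto
  also have "\<dots> = 2 * 6 ^ 6 * (1 / ?\<rho>) ^ 5"
    using \<rho> power_quotients(2)[of ?\<rho>] by (simp only: mult.assoc)
  also have "\<dots> \<le> 2 * 6 ^ 6 * (5 / \<delta>\<^sup>2) ^ 5"
  proof (intro mult_left_mono power_mono)
    show "1 / ?\<rho> \<le> 5 / \<delta>\<^sup>2"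
      using r_bounds(2)[of t] \<rho> delta by (simp add: field_simps)
  qed (use \<rho> in auto)
  also have "\<dots> = 291600000 / \<delta> ^ 10"
    by (simp add: power_divide power_mult[symmetric])
  also have "\<dots> \<le> 400000000 / \<delta> ^ 10"
    using delta by (intro divide_right_mono) auto
  also have "\<dots> = (20000 / \<delta> ^ 5)\<^sup>2"
    by (simp add: power_divide power_mult[symmetric])
  finally show "(\<Sum>k\<in>F. (1 + (of_int k)\<^sup>2) * (norm (dxx (u t) k))\<^sup>2) \<le> (20000 / \<delta> ^ 5)\<^sup>2" .
qed

lemma u_0: "fourier_series (u 0) x = cis x + of_real \<delta>"
proof -
  have "sn 0 = 0" "cs 0 = 1" by (simp_all add: sn_def cs_def)
  then have "p 0 = 0" "b 0 = of_real \<delta>" "c 0 = 1"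
    by (simp_all add: p_def q_def b_def c_def a_def A_def E_def \<beta>_def complex_eq_iff)
  then show ?thesis by (simp add: u_fourier_series(2))
qed

end

section \<open>Perturbation of the explicit solution\<close>

lemma mult_cos_le_sin:
  fixes x :: real
  assumes "0 \<le> x" "x \<le> pi"
  shows "x * cos x \<le> sin x"
proof -
  have "sin 0 - 0 * cos 0 \<le> sin x - x * cos x"
  proof (rule DERIV_nonneg_imp_nondecreasing[OF assms(1)])
    fix s assume s: "0 \<le> s" "s \<le> x"
    have "((\<lambda>s. sin s - s * cos s) has_real_derivative s * sin s) (at s)"
      by (auto intro!: derivative_eq_intros)
    moreover have "0 \<le> s * sin s" using s assms by (intro mult_nonneg_nonneg sin_ge_zero) auto
    ultimately show "\<exists>y. ((\<lambda>s. sin s - s * cos s) has_real_derivative y) (at s) \<and> 0 \<le> y" by blast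
  qed
  then show ?thesis by simp
qed

text \<open>By \<open>sin x = 2 sin (x / 2) cos (x / 2) \<ge> x cos\<^sup>2 (x / 2)\<close>.\<close>
lemma half_le_sin:
  fixes x :: real
  assumes "0 \<le> x" "x \<le> pi / 2"
  shows "x / 2 \<le> sin x"
proof -
  have c: "0 \<le> cos x" "0 \<le> cos (x / 2)" using assms by (auto intro!: cos_ge_zero)
  have "x / 2 * 1 \<le> x / 2 * (1 + cos x)" using assms c by (intro mult_left_mono) auto
  also have "1 + cos x = 2 * (cos (x / 2))\<^sup>2"
    using cos_double_cos[of "x / 2"] by simp
  also have "x / 2 * (2 * (cos (x / 2))\<^sup>2) = 2 * (x / 2 * cos (x / 2)) * cos (x / 2)"
    by (simp add: power2_eq_square)
  also have "\<dots> \<le> 2 * sin (x / 2) * cos (x / 2)"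
    using mult_cos_le_sin[of "x / 2"] assms c by (intro mult_right_mono) auto
  also have "\<dots> = sin x" using sin_double[of "x / 2"] by simp
  finally show ?thesis by simp
qed

context szego_orbit
begin

definition T :: real where "T = pi / (\<delta> * \<sigma>)"

lemma omega_T: "\<omega> * T = pi / 2" "0 < T" "\<delta> \<le> \<omega>"
  using sigma_ge delta by (auto simp: \<omega>_def T_def field_simps)

lemma omega_range:
  assumes "0 \<le> t" "t \<le> T"
  shows "0 \<le> pi / 2 - \<omega> * t" "pi / 2 - \<omega> * t \<le> pi / 2"
proof -
  have "0 \<le> \<omega> * t" "\<omega> * t \<le> \<omega> * T"
    using assms omega_T delta by (auto intro!: mult_left_mono)
  then show "0 \<le> pi / 2 - \<omega> * t" "pi / 2 - \<omega> * t \<le> pi / 2"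
    using omega_T(1) by auto
qed

definition \<phi> :: "real \<Rightarrow> real" where "\<phi> t = pi / 2 - \<omega> * t"

lemma inverse_one_minus_r_le:
  assumes "0 \<le> t" "t \<le> T"
  shows "1 / (1 - r t) \<le> 5 / (\<delta>\<^sup>2 + (\<phi> t)\<^sup>2)"
proof -
  have "cs t = sin (\<phi> t)" by (simp add: cs_def \<phi>_def sin_diff)
  then have "\<phi> t / 2 \<le> cs t"
    using half_le_sin[of "\<phi> t"] omega_range[OF assms] by (simp add: \<phi>_def)
  moreover have "0 \<le> \<phi> t" using omega_range[OF assms] by (simp add: \<phi>_def)
  ultimately have "(\<phi> t / 2)\<^sup>2 \<le> (cs t)\<^sup>2" by (intro power_mono) auto
  then have *: "\<delta>\<^sup>2 + (\<phi> t)\<^sup>2 \<le> \<delta>\<^sup>2 + 4 * (cs t)\<^sup>2" by (simp add: power_divide)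
  have d: "0 < \<delta>\<^sup>2" "\<delta>\<^sup>2 \<le> 1" using delta by (auto simp: power_le_one)
  have "1 / (1 - r t) = (4 + \<delta>\<^sup>2) / (\<delta>\<^sup>2 + 4 * (cs t)\<^sup>2)"
    by (simp add: one_minus_r)
  also have "\<dots> \<le> 5 / (\<delta>\<^sup>2 + (\<phi> t)\<^sup>2)"
    using * d by (intro frac_le) (auto simp: add_pos_nonneg)
  finally show ?thesis .
qed

text \<open>The primitive of \<open>1 / (\<delta>\<^sup>2 + \<phi>\<^sup>2)\<close> vanishing at time \<open>0\<close>. It dominates the integral of \<open>\<parallel>u\<parallel>\<^sup>2\<close> up to a
  constant, and the arctangent makes it \<open>O(\<delta>\<^sup>-\<^sup>2)\<close> at time \<open>T\<close>.\<close>
definition \<Phi> :: "real \<Rightarrow> real" where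
  "\<Phi> t = 1 / (\<delta> * \<omega>) * (arctan (pi / 2 / \<delta>) - arctan (\<phi> t / \<delta>))"

lemma Phi_deriv: "(\<Phi> has_real_derivative 1 / (\<delta>\<^sup>2 + (\<phi> t)\<^sup>2)) (at t)"
proof -
  have pos: "\<omega> > 0" using omega_T(3) delta by linarith
  have "((\<lambda>t. \<phi> t / \<delta>) has_real_derivative (- \<omega> / \<delta>)) (at t)"
    unfolding \<phi>_def using delta by (auto intro!: derivative_eq_intros)
  then have "((\<lambda>t. arctan (\<phi> t / \<delta>)) has_real_derivative (inverse (1 + (\<phi> t / \<delta>)\<^sup>2) * (- \<omega> / \<delta>))) (at t)"
    using DERIV_chain2[OF DERIV_arctan] by blast
  then have "(\<Phi> has_real_derivative 1 / (\<delta> * \<omega>) * (0 - inverse (1 + (\<phi> t / \<delta>)\<^sup>2) * (- \<omega> / \<delta>))) (at t)"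
    unfolding \<Phi>_def[abs_def] by (intro DERIV_cmult DERIV_diff DERIV_const)
  moreover have "1 / (\<delta> * \<omega>) * (0 - inverse (1 + (\<phi> t / \<delta>)\<^sup>2) * (- \<omega> / \<delta>)) = 1 / (\<delta>\<^sup>2 + (\<phi> t)\<^sup>2)"
  proof -
    have "1 + (\<phi> t / \<delta>)\<^sup>2 = (\<delta>\<^sup>2 + (\<phi> t)\<^sup>2) / \<delta>\<^sup>2"
      using delta by (simp add: field_simps)
    then show ?thesis using pos delta by (simp add: power2_eq_square)
  qed
  ultimately show ?thesis by simp
qed

lemma Phi_bounds:
  assumes "0 \<le> t" "t \<le> T"
  shows "0 \<le> \<Phi> t" "\<Phi> t \<le> pi / (2 * \<delta>\<^sup>2)"
proof -
  have pos: "\<omega> > 0" using omega_T(3) delta by linarith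
  have f: "0 \<le> \<phi> t" "\<phi> t \<le> pi / 2" using omega_range[OF assms] by (auto simp: \<phi>_def)
  then have "\<phi> t / \<delta> \<le> pi / 2 / \<delta>"
    using delta by (intro divide_right_mono) auto
  then have "arctan (\<phi> t / \<delta>) \<le> arctan (pi / 2 / \<delta>)"
    by (simp only: arctan_le_iff)
  then show "0 \<le> \<Phi> t" using pos delta by (simp add: \<Phi>_def)
  have "0 \<le> arctan (\<phi> t / \<delta>)" using f delta by (simp add: zero_le_arctan_iff)
  then have *: "arctan (pi / 2 / \<delta>) - arctan (\<phi> t / \<delta>) \<le> pi / 2"
    using arctan_ubound[of "pi / 2 / \<delta>"] by linarith
  have "\<Phi> t \<le> 1 / (\<delta> * \<omega>) * (pi / 2)"
    unfolding \<Phi>_def using * pos delta by (intro mult_left_mono) auto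
  also have "\<dots> \<le> 1 / (\<delta> * \<delta>) * (pi / 2)"
    using pos delta omega_T(3) by (intro mult_right_mono divide_left_mono mult_left_mono) auto
  also have "\<dots> = pi / (2 * \<delta>\<^sup>2)" by (simp add: power2_eq_square)
  finally show "\<Phi> t \<le> pi / (2 * \<delta>\<^sup>2)" .
qed

lemma u'_eq: "u' t k = - \<i> * szego_proj (cubic (u t)) k"
  using szego_equation[of k t, symmetric] u'_negative[of k t]
  by (cases "k \<ge> 0") (simp_all add: szego_proj_def mult.assoc[symmetric])

text \<open>Each mode moves with speed at most that of the cubic term, whose norm is bounded in time. This
  gives the continuity in time of the norm of the difference from a perturbed solution.\<close>
lemma u_Lipschitz: "\<exists>L. \<forall>s t. H1_norm (\<lambda>k. u s k - u t k) \<le> L * \<bar>s - t\<bar>"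
proof -
  define L where "L = algebra_const\<^sup>2 * (sqrt (30 / \<delta>\<^sup>2)) ^ 3"
  have u'_le: "H1_le (u' s) L" for s
  proof -
    have "6 / (1 - r s) \<le> 6 / (\<delta>\<^sup>2 / 5)"
      using r_bounds(2,3)[of s] delta by (intro divide_left_mono mult_pos_pos) auto
    then have "sqrt (6 / (1 - r s)) \<le> sqrt (30 / \<delta>\<^sup>2)" by simp
    from H1_le_mono[OF u_H1_le this] have "H1_le (cubic (u s)) L"
      unfolding L_def by (rule H1_le_cubic)
    from H1_le_cmult[OF H1_le_szego_proj[OF this], of "- \<i>"]
    show ?thesis by (simp add: u'_eq[abs_def])
  qed
  have ordered: "H1_norm (\<lambda>k. u s k - u t k) \<le> L * (s - t)" if "t \<le> s" for s t
  proof -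
    have "H1_le (\<lambda>k. u s k - u t k) (0 + (L * s - L * t))"
    proof (rule H1_le_duhamel[OF that, where \<mu> = "\<lambda>_. 0" and F = u' and g' = "\<lambda>_. L" and g = "\<lambda>s. L * s"])
      fix x k
      show "((\<lambda>r. u r k - u t k) has_vector_derivative \<i> * of_real 0 * (u x k - u t k) + u' x k) (at x)"
        using has_vector_derivative_diff[OF u_deriv has_vector_derivative_const] by simp
      show "((*) L has_real_derivative L) (at x)"
        by (auto intro!: derivative_eq_intros)
      show "H1_le (u' x) L" by (rule u'_le)
      show "H1_le (\<lambda>k. u t k - u t k) 0" by (simp add: H1_le_def)
    qed
    then show ?thesis by (metis H1_norm_le add_0 right_diff_distrib)
  qed
  have sym: "H1_norm (\<lambda>k. u s k - u t k) = H1_norm (\<lambda>k. u t k - u s k)" for s t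
    by (simp add: H1_norm_def norm_minus_commute)
  have "H1_norm (\<lambda>k. u s k - u t k) \<le> L * \<bar>s - t\<bar>" for s t
  proof (cases "t \<le> s")
    case True
    then show ?thesis using ordered[of t s] by simp
  next
    case False
    then show ?thesis using ordered[of s t] sym[of s t] by simp
  qed
  then show ?thesis by blast
qed

text \<open>The rate \<open>\<Lambda> / (\<delta>\<^sup>2 + \<phi>\<^sup>2)\<close> covers the nonlinear term, \<open>210 = 7 * 6 * 5\<close> collecting the constants
  of \<open>H1_le_cubic_diff\<close>, \<open>u_H1_le\<close> and \<open>inverse_one_minus_r_le\<close>, and leaves \<open>1\<close> for the source.\<close>
definition \<Lambda> :: real where "\<Lambda> = 210 * algebra_const\<^sup>2 + 1"

text \<open>The barrier is \<open>G = B exp (\<Lambda> \<Phi>)\<close>. While the norm \<open>y\<close> of the difference stays below \<open>G \<le> 1 / 2\<close>,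
  the source is bounded by \<open>G'\<close>, and \<open>H1_le_duhamel\<close> gives \<open>y t \<le> G t - G 0 < G t\<close>; so contact never
  occurs. The constant \<open>B\<close> is five times the bound on the dispersive source, because
  \<open>\<delta>\<^sup>2 + \<phi>\<^sup>2 \<le> 5\<close>.\<close>
lemma perturbation_bound:
  assumes sol: "nls_szego_solution 1 \<nu> (\<lambda>x. cis x + complex_of_real \<delta>) U"
    and \<nu>: "\<nu> > 0"
    and small: "\<nu>\<^sup>2 * (100000 / \<delta> ^ 5) * exp (\<Lambda> * (pi / (2 * \<delta>\<^sup>2))) \<le> 1 / 2"
  shows "H1_norm (\<lambda>k. fourier_coeff (U T) k - u T k) \<le> 1 / 2"
proof -
  define a where "a t = fourier_coeff (U t)" for t
  define w where "w t k = a t k - u t k" for t k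
  define y where "y t = H1_norm (w t)" for t
  define B where "B = \<nu>\<^sup>2 * (100000 / \<delta> ^ 5)"
  define G where "G t = B * exp (\<Lambda> * \<Phi> t)" for t
  have B_pos: "B > 0" using \<nu> delta by (simp add: B_def)
  have Hs: "U t \<in> Hs_plus 1" for t
    using sol by (simp add: nls_szego_solution_def continuous_into_Hs_plus_def)
  then have L2: "U t \<in> L2_circle" and a_neg: "k < 0 \<Longrightarrow> a t k = 0" for t k
    by (auto simp: Hs_plus_def L2_plus_iff a_def)
  have a_H1: "H1_le (a t) (sobolev_norm 1 (U t))" for t
    unfolding a_def using Hs by (intro Hs_circle_H1_le) (auto simp: Hs_plus_def)
  have w_H1': "H1_le (w t) (sobolev_norm 1 (U t) + sqrt (6 / (1 - r t)))" for t
    unfolding w_def[abs_def] by (rule H1_le_diff[OF a_H1 u_H1_le])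
  then have w_H1: "H1_le (w t) (y t)" for t
    unfolding y_def by (rule H1_le_H1_norm)

  have y_cont: "isCont y t" for t
  proof -
    obtain L where L: "\<And>s t. H1_norm (\<lambda>k. u s k - u t k) \<le> L * \<bar>s - t\<bar>"
      using u_Lipschitz by blast
    have bound: "norm (y s - y t) \<le> sobolev_norm 1 (\<lambda>x. U s x - U t x) + L * \<bar>s - t\<bar>" for s
    proof -
      have fd: "fourier_coeff (\<lambda>x. U s x - U t x) = (\<lambda>k. a s k - a t k)"
        unfolding a_def by (intro ext fourier_coeff_diff L2_circle_set_integrable L2)
      have "\<bar>y s - y t\<bar> \<le> H1_norm (\<lambda>k. w s k - w t k)"
        unfolding y_def by (rule H1_norm_diff_le[OF w_H1' w_H1'])
      also have "\<dots> \<le> H1_norm (\<lambda>k. a s k - a t k) + H1_norm (\<lambda>k. u s k - u t k)"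
      proof -
        have "H1_le (\<lambda>k. (a s k - a t k) - (u s k - u t k))
            (H1_norm (\<lambda>k. a s k - a t k) + H1_norm (\<lambda>k. u s k - u t k))"
          by (intro H1_le_diff H1_le_H1_norm[OF H1_le_diff[OF a_H1 a_H1]]
              H1_le_H1_norm[OF H1_le_diff[OF u_H1_le u_H1_le]])
        moreover have "(\<lambda>k. (a s k - a t k) - (u s k - u t k)) = (\<lambda>k. w s k - w t k)"
          by (simp add: w_def algebra_simps)
        ultimately show ?thesis by (metis H1_norm_le)
      qed
      also have "\<dots> \<le> sobolev_norm 1 (\<lambda>x. U s x - U t x) + L * \<bar>s - t\<bar>"
        unfolding sobolev_norm_1_eq fd using L by simp
      finally show ?thesis by (simp only: real_norm_def)
    qed
    have "((\<lambda>s. sobolev_norm 1 (\<lambda>x. U s x - U t x) + L * \<bar>s - t\<bar>) \<longlongrightarrow> 0 + L * \<bar>t - t\<bar>) (at t)"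
      using sol by (intro tendsto_intros) (simp add: nls_szego_solution_def continuous_into_Hs_plus_def)
    then have "((\<lambda>s. sobolev_norm 1 (\<lambda>x. U s x - U t x) + L * \<bar>s - t\<bar>) \<longlongrightarrow> 0) (at t)"
      by simp
    then have "((\<lambda>s. y s - y t) \<longlongrightarrow> 0) (at t)"
      by (rule Lim_null_comparison[OF always_eventually[OF allI[OF bound]]])
    then show ?thesis unfolding isCont_def by (rule LIM_zero_cancel)
  qed

  have w_0: "w 0 = (\<lambda>k. 0)"
  proof
    fix k
    have "a 0 k = fourier_coeff (fourier_series (u 0)) k"
      unfolding a_def
    proof (rule fourier_coeff_cong_AE)
      show "U 0 \<in> borel_measurable borel" using L2[of 0] by (simp add: L2_circle_def)
      show "fourier_series (u 0) \<in> borel_measurable borel"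
        by (rule fourier_series_measurable[OF u_fourier_series(1)])
      have "AE x in lborel. U 0 x = cis x + of_real \<delta>"
        using sol by (simp add: nls_szego_solution_def)
      then show "AE x in lborel. x \<in> {0..2 * pi} \<longrightarrow> U 0 x = fourier_series (u 0) x"
        by eventually_elim (simp add: u_0)
    qed
    also have "\<dots> = u 0 k" by (rule fourier_coeff_fourier_series[OF u_fourier_series(1)])
    finally show "w 0 k = 0" by (simp add: w_def)
  qed

  define F where "F s k = - \<i> * szego_proj (\<lambda>k. cubic (\<lambda>k. u s k + w s k) k - cubic (u s) k) k
      + \<i> * of_real (\<nu>\<^sup>2) * dxx (u s) k" for s k
  have w_deriv: "((\<lambda>r. w r k) has_vector_derivative
      (\<i> * of_real (- (\<nu>\<^sup>2 * (of_int k)\<^sup>2)) * w s k + F s k)) (at s)" for s k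
  proof -
    have a_sum: "fourier_coeff (U s) abs_summable_on UNIV"
      using H1_le_abs_summable[OF a_H1[of s]] by (simp add: a_def)
    from sol obtain V where V: "((\<lambda>r. a r k) has_vector_derivative V k) (at s)"
      and V_eq: "\<i> * V k + complex_of_real (\<nu>\<^sup>2) * dxx (a s) k
        = szego_proj (fourier_coeff (\<lambda>x. complex_of_real ((norm (U s x))\<^sup>2) * U s x)) k"
      unfolding nls_szego_solution_def satisfies_nls_szego_def a_def by blast
    have "\<i> * V k + complex_of_real (\<nu>\<^sup>2) * dxx (a s) k = szego_proj (cubic (a s)) k"
      using V_eq unfolding fourier_coeff_cubic[OF L2 a_sum] a_def .
    then have "\<i> * V k = szego_proj (cubic (a s)) k - complex_of_real (\<nu>\<^sup>2) * dxx (a s) k"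
      by (simp add: eq_diff_eq)
    then have "- \<i> * (\<i> * V k) = - \<i> * (szego_proj (cubic (a s)) k - complex_of_real (\<nu>\<^sup>2) * dxx (a s) k)"
      by (rule arg_cong)
    then have V_k: "V k = - \<i> * szego_proj (cubic (a s)) k + \<i> * of_real (\<nu>\<^sup>2) * dxx (a s) k"
      by (simp add: algebra_simps)
    have a_eq: "(\<lambda>k. u s k + w s k) = a s" by (simp add: w_def fun_eq_iff)
    have dxx_eq: "dxx (a s) k = dxx (u s) k - (of_int k)\<^sup>2 * w s k"
      unfolding a_eq[symmetric] by (simp add: dxx_def power_mult_distrib algebra_simps)
    have "V k - u' s k = \<i> * of_real (- (\<nu>\<^sup>2 * (of_int k)\<^sup>2)) * w s k + F s k"
      unfolding V_k u'_eq F_def a_eq dxx_eq by (simp add: szego_proj_def algebra_simps)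
    then show ?thesis
      using has_vector_derivative_diff[OF V u_deriv[of k s]] unfolding w_def by simp
  qed

  have G_deriv: "(G has_real_derivative \<Lambda> / (\<delta>\<^sup>2 + (\<phi> s)\<^sup>2) * G s) (at s)" for s
    unfolding G_def using Phi_deriv[of s]
    by (auto intro!: derivative_eq_intros)
  have Lam: "\<Lambda> \<ge> 1" by (simp add: \<Lambda>_def)
  have G_ge: "B \<le> G s" if "0 \<le> s" "s \<le> T" for s
  proof -
    have "0 \<le> \<Lambda> * \<Phi> s" using Phi_bounds(1)[OF that] Lam by simp
    then show ?thesis using B_pos by (simp add: G_def)
  qed
  have G_le: "G s \<le> 1 / 2" if "0 \<le> s" "s \<le> T" for s
  proof -
    have "exp (\<Lambda> * \<Phi> s) \<le> exp (\<Lambda> * (pi / (2 * \<delta>\<^sup>2)))"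
      using Phi_bounds(2)[OF that] Lam by (simp only: exp_le_cancel_iff) (intro mult_left_mono; simp)
    then have "G s \<le> B * exp (\<Lambda> * (pi / (2 * \<delta>\<^sup>2)))"
      unfolding G_def using B_pos by (intro mult_left_mono) auto
    also have "\<dots> \<le> 1 / 2" using small by (simp add: B_def)
    finally show ?thesis .
  qed

  have F_H1: "H1_le (F s) (\<Lambda> / (\<delta>\<^sup>2 + (\<phi> s)\<^sup>2) * G s)"
    if s: "0 \<le> s" "s \<le> T" and le: "y s \<le> G s" for s
  proof -
    let ?\<rho> = "1 - r s" and ?D = "\<delta>\<^sup>2 + (\<phi> s)\<^sup>2"
    have \<rho>: "0 < ?\<rho>" "?\<rho> \<le> 1" using r_bounds(3,4)[of s] by auto
    have D_pos: "?D > 0" using delta by (simp add: add_pos_nonneg)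
    have D_le: "?D \<le> 5"
    proof -
      have "\<delta>\<^sup>2 \<le> 1" using delta by (simp add: power_le_one)
      moreover have "(\<phi> s)\<^sup>2 \<le> 2\<^sup>2"
      proof (rule power_mono)
        show "\<phi> s \<le> 2" "0 \<le> \<phi> s"
          using omega_range[OF s] pi_less_4 unfolding \<phi>_def by linarith+
      qed
      ultimately show ?thesis by simp
    qed
    define M where "M = sqrt (6 / ?\<rho>)"
    have "1 \<le> 6 / ?\<rho>" using \<rho> by simp
    then have "1 \<le> M" by (simp add: M_def)
    have M_sq: "M\<^sup>2 = 6 / ?\<rho>" using \<rho> by (simp add: M_def)
    have w_G: "H1_le (w s) (G s)" using H1_le_mono[OF w_H1 le] .
    have "G s \<le> M" using G_le[OF s] \<open>1 \<le> M\<close> by simp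
    have "H1_le (\<lambda>k. cubic (\<lambda>k. u s k + w s k) k - cubic (u s) k) (7 * algebra_const\<^sup>2 * M\<^sup>2 * G s)"
      using u_H1_le w_G \<open>G s \<le> M\<close> unfolding M_def by (rule H1_le_cubic_diff)
    from H1_le_cmult[OF H1_le_szego_proj[OF this], of "- \<i>"]
    have cubic_part: "H1_le (\<lambda>k. - \<i> * szego_proj (\<lambda>k. cubic (\<lambda>k. u s k + w s k) k - cubic (u s) k) k)
        (7 * algebra_const\<^sup>2 * M\<^sup>2 * G s)" by simp
    have dxx_part: "H1_le (\<lambda>k. \<i> * of_real (\<nu>\<^sup>2) * dxx (u s) k) (\<nu>\<^sup>2 * (20000 / \<delta> ^ 5))"
      using H1_le_cmult[OF dxx_u_H1_le, of "\<i> * of_real (\<nu>\<^sup>2)" s] by (simp add: norm_mult norm_power)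
    have F_le: "H1_le (F s) (7 * algebra_const\<^sup>2 * M\<^sup>2 * G s + \<nu>\<^sup>2 * (20000 / \<delta> ^ 5))"
      unfolding F_def[abs_def] by (rule H1_le_add[OF cubic_part dxx_part])
    have G_nonneg: "0 \<le> G s" using B_pos by (simp add: G_def)
    have "7 * algebra_const\<^sup>2 * M\<^sup>2 * G s = 42 * algebra_const\<^sup>2 * G s * (1 / ?\<rho>)"
      by (simp add: M_sq)
    also have "\<dots> \<le> 42 * algebra_const\<^sup>2 * G s * (5 / ?D)"
      using inverse_one_minus_r_le[OF s] G_nonneg by (intro mult_left_mono) auto
    finally have 1: "7 * algebra_const\<^sup>2 * M\<^sup>2 * G s \<le> 210 * algebra_const\<^sup>2 * G s / ?D"
      by simp
    have "\<nu>\<^sup>2 * (20000 / \<delta> ^ 5) = B / 5" by (simp add: B_def)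
    also have "\<dots> \<le> G s / 5" using G_ge[OF s] by simp
    also have "\<dots> \<le> G s / ?D" using G_nonneg D_pos D_le by (intro divide_left_mono) auto
    finally have 2: "\<nu>\<^sup>2 * (20000 / \<delta> ^ 5) \<le> G s / ?D" .
    have "7 * algebra_const\<^sup>2 * M\<^sup>2 * G s + \<nu>\<^sup>2 * (20000 / \<delta> ^ 5)
        \<le> 210 * algebra_const\<^sup>2 * G s / ?D + G s / ?D"
      using 1 2 by (rule add_mono)
    also have "\<dots> = \<Lambda> / ?D * G s"
      by (simp add: \<Lambda>_def add_divide_distrib ring_distribs)
    finally show ?thesis by (rule H1_le_mono[OF F_le])
  qed

  have "y T < G T"
  proof (rule barrier[of T y G])
    show "continuous_on {0..T} y"
      using y_cont by (simp add: continuous_at_imp_continuous_on)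
    show "continuous_on {0..T} G"
      using G_deriv by (intro DERIV_continuous_on) (blast intro: has_field_derivative_at_within)
    have "y 0 \<le> 0" unfolding y_def w_0 by (rule H1_norm_le) (simp add: H1_le_def)
    then show "y 0 < G 0" using G_ge[of 0] B_pos omega_T(2) by simp
    show "0 \<le> T" "T \<le> T" using omega_T(2) by auto
    fix t assume t: "0 \<le> t" "t \<le> T" and le: "\<And>s. 0 \<le> s \<Longrightarrow> s \<le> t \<Longrightarrow> y s \<le> G s"
    have "H1_le (w t) (0 + (G t - G 0))"
    proof (rule H1_le_duhamel[OF t(1)])
      fix s assume s: "0 \<le> s" "s \<le> t"
      show "((\<lambda>r. w r k) has_vector_derivative
          (\<i> * of_real (- (\<nu>\<^sup>2 * (of_int k)\<^sup>2)) * w s k + F s k)) (at s)" for k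
        by (rule w_deriv)
      show "H1_le (F s) (\<Lambda> / (\<delta>\<^sup>2 + (\<phi> s)\<^sup>2) * G s)"
        using s t by (intro F_H1 le) auto
      show "(G has_real_derivative \<Lambda> / (\<delta>\<^sup>2 + (\<phi> s)\<^sup>2) * G s) (at s)"
        by (rule G_deriv)
    next
      show "H1_le (w 0) 0" unfolding w_0 by (simp add: H1_le_def)
    qed
    then have "y t \<le> G t - G 0" unfolding y_def using H1_norm_le by fastforce
    moreover have "G 0 > 0" using B_pos by (simp add: G_def)
    ultimately show "y t < G t" by linarith
  qed
  also have "\<dots> \<le> 1 / 2" using G_le omega_T(2) by simp
  finally show ?thesis by (simp add: y_def w_def[abs_def] a_def)
qed

lemma norm_u_T: "2 / \<delta> \<le> H1_norm (u T)" "H1_norm (u T) \<le> 9 / \<delta>"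
proof -
  have "cs T = 0" by (simp add: cs_def omega_T)
  then have \<rho>: "1 - r T = \<delta>\<^sup>2 / \<sigma>\<^sup>2" by (simp add: one_minus_r sigma_sq)
  have "sqrt (1 - r T) = \<delta> / \<sigma>"
    unfolding \<rho> using delta sigma_ge by (simp add: real_sqrt_divide)
  then have "\<sigma> / \<delta> \<le> H1_norm (u T)" using u_H1_norm_ge[of T] by simp
  moreover have "2 / \<delta> \<le> \<sigma> / \<delta>" using sigma_ge delta by (intro divide_right_mono) auto
  ultimately show "2 / \<delta> \<le> H1_norm (u T)" by linarith
  have "\<delta>\<^sup>2 \<le> 1" using delta by (simp add: power_le_one)
  then have "\<sigma>\<^sup>2 \<le> 5" by (simp add: sigma_sq)
  have "H1_norm (u T) \<le> sqrt (6 / (1 - r T))" by (rule H1_norm_le[OF u_H1_le])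
  also have "\<dots> \<le> 9 / \<delta>"
  proof (rule real_le_lsqrt)
    have "6 / (1 - r T) = 6 * \<sigma>\<^sup>2 / \<delta>\<^sup>2" unfolding \<rho> by simp
    also have "\<dots> \<le> 81 / \<delta>\<^sup>2" using \<open>\<sigma>\<^sup>2 \<le> 5\<close> by (intro divide_right_mono) auto
    finally show "6 / (1 - r T) \<le> (9 / \<delta>)\<^sup>2" by (simp add: power_divide)
  qed (use delta in auto)
  finally show "H1_norm (u T) \<le> 9 / \<delta>" .
qed

end

theorem theorem1p9:
  "\<exists>K::real. K > 0 \<and>
     (\<exists>\<delta>0::real. \<delta>0 > 0 \<and> (\<exists>c::real. c > 0 \<and>
       (\<forall>\<delta>::real. 0 < \<delta> \<and> \<delta> < \<delta>0 \<longrightarrow>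
         (\<forall>U :: real \<Rightarrow> real \<Rightarrow> complex.
            nls_szego_solution 1 (exp (- (pi * K / (2 * \<delta>\<^sup>2))))
              (\<lambda>x. cis x + complex_of_real \<delta>) U \<longrightarrow>
            (let t\<^sub>\<delta> = pi / (\<delta> * sqrt (4 + \<delta>\<^sup>2)) in
               inverse c * (1 / \<delta>) \<le> sobolev_norm 1 (U t\<^sub>\<delta>) \<and>
               sobolev_norm 1 (U t\<^sub>\<delta>) \<le> c * (1 / \<delta>))))))"
proof -
  \<comment> \<open>the rate \<open>\<Lambda>\<close>: one half of the decay of \<open>\<nu>\<^sup>2\<close> cancels the amplification, the other half remains\<close>
  define K where "K = 210 * algebra_const\<^sup>2 + 1"
  have K: "K \<ge> 1" by (simp add: K_def)
  have main: "inverse 10 * (1 / \<delta>) \<le> sobolev_norm 1 (U (pi / (\<delta> * sqrt (4 + \<delta>\<^sup>2)))) \<and>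
      sobolev_norm 1 (U (pi / (\<delta> * sqrt (4 + \<delta>\<^sup>2)))) \<le> 10 * (1 / \<delta>)"
    if \<delta>: "0 < \<delta>" "\<delta> < 1 / 10000000"
      and sol: "nls_szego_solution 1 (exp (- (pi * K / (2 * \<delta>\<^sup>2)))) (\<lambda>x. cis x + complex_of_real \<delta>) U"
    for \<delta> U
  proof -
    interpret szego_orbit \<delta> by standard (use \<delta> in auto)
    have T_eq: "pi / (\<delta> * sqrt (4 + \<delta>\<^sup>2)) = T" by (simp add: T_def \<sigma>_def)
    have Lambda_eq: "\<Lambda> = K" by (simp add: \<Lambda>_def K_def)
    let ?\<nu> = "exp (- (pi * K / (2 * \<delta>\<^sup>2)))"
    have small: "?\<nu>\<^sup>2 * (100000 / \<delta> ^ 5) * exp (\<Lambda> * (pi / (2 * \<delta>\<^sup>2))) \<le> 1 / 2"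
    proof -
      have "?\<nu>\<^sup>2 * exp (\<Lambda> * (pi / (2 * \<delta>\<^sup>2))) = ?\<nu> * (?\<nu> * exp (K * (pi / (2 * \<delta>\<^sup>2))))"
        unfolding Lambda_eq by (simp add: power2_eq_square)
      also have "?\<nu> * exp (K * (pi / (2 * \<delta>\<^sup>2))) = 1"
        by (simp flip: exp_add add: mult.commute)
      finally have eq: "?\<nu>\<^sup>2 * exp (\<Lambda> * (pi / (2 * \<delta>\<^sup>2))) = ?\<nu>" by simp
      \<comment> \<open>\<open>exp x \<ge> (x / 3) ^ 3\<close> with \<open>x = 1 / \<delta>\<^sup>2\<close> beats the factor \<open>1 / \<delta> ^ 5\<close>\<close>
      have "?\<nu> \<le> 27 * \<delta> ^ 6"
      proof -
        have "2 * 1 \<le> pi * K" using K pi_ge_two by (intro mult_mono) auto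
        then have "1 / \<delta>\<^sup>2 \<le> pi * K / (2 * \<delta>\<^sup>2)"
          using \<delta> by (simp add: divide_le_cancel field_simps)
        then have "?\<nu> \<le> exp (- (1 / \<delta>\<^sup>2))" by simp
        also have "\<dots> = 1 / exp (1 / \<delta>\<^sup>2)" by (simp add: exp_minus inverse_eq_divide)
        also have "\<dots> \<le> 1 / (1 / (27 * \<delta> ^ 6))"
        proof (rule divide_left_mono)
          have "1 / (27 * \<delta> ^ 6) = (1 / \<delta>\<^sup>2 / 3) ^ 3"
            by (simp add: power_divide power_mult[symmetric] power_mult_distrib)
          also have "\<dots> \<le> exp (1 / \<delta>\<^sup>2 / 3) ^ 3"
          proof (rule power_mono)
            show "1 / \<delta>\<^sup>2 / 3 \<le> exp (1 / \<delta>\<^sup>2 / 3)"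
              using exp_ge_add_one_self[of "1 / \<delta>\<^sup>2 / 3"] by linarith
          qed simp
          also have "\<dots> = exp (1 / \<delta>\<^sup>2)" by (simp flip: exp_of_nat_mult)
          finally show "1 / (27 * \<delta> ^ 6) \<le> exp (1 / \<delta>\<^sup>2)" .
        qed (use \<delta> in auto)
        finally show ?thesis by simp
      qed
      then have "?\<nu> * (100000 / \<delta> ^ 5) \<le> 27 * \<delta> ^ 6 * (100000 / \<delta> ^ 5)"
        using \<delta> by (intro mult_right_mono) auto
      also have "\<dots> = 2700000 * \<delta>" using \<delta> by (simp add: eval_nat_numeral field_simps)
      also have "\<dots> \<le> 1 / 2" using \<delta> by simp
      finally have "(?\<nu>\<^sup>2 * exp (\<Lambda> * (pi / (2 * \<delta>\<^sup>2)))) * (100000 / \<delta> ^ 5) \<le> 1 / 2"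
        unfolding eq .
      then show ?thesis by (simp only: mult_ac)
    qed
    have diff: "H1_norm (\<lambda>k. fourier_coeff (U T) k - u T k) \<le> 1 / 2"
      using perturbation_bound[OF sol _ small] by simp
    have "U T \<in> Hs_circle 1"
      using sol by (simp add: nls_szego_solution_def continuous_into_Hs_plus_def Hs_plus_def)
    from H1_norm_diff_le[OF Hs_circle_H1_le[OF this] u_H1_le[of T]] diff
    have "\<bar>sobolev_norm 1 (U T) - H1_norm (u T)\<bar> \<le> 1 / 2"
      by (simp add: sobolev_norm_1_eq)
    moreover have "1 \<le> 1 / \<delta>" using \<delta> by simp
    moreover have "2 / \<delta> = 2 * (1 / \<delta>)" "9 / \<delta> = 9 * (1 / \<delta>)" by auto
    ultimately have "1 / 10 * (1 / \<delta>) \<le> sobolev_norm 1 (U T)" "sobolev_norm 1 (U T) \<le> 10 * (1 / \<delta>)"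
      using norm_u_T by linarith+
    then show ?thesis unfolding T_eq inverse_eq_divide by blast
  qed
  show ?thesis
    using K main unfolding Let_def
    by (intro exI[of _ K] conjI exI[of _ "1 / 10000000"] exI[of _ 10] allI impI) auto
qed

end
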